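(* Let $L_1,L_2>0$, $\Omega=(0,L_1)\times(0,L_2)$, $\lambda>0$, $T\theta=\theta_y+\lambda\theta_x$, and $\Gamma=\Gamma_W\cup\Gamma_S$ where $\Gamma_W=\{x=0\}$, $\Gamma_S=\{y=0\}$. Let $\mathcal{X}_\Gamma(\Omega)=\{\theta\in L^2(\Omega):\ T\theta\in L^2(\Omega),\ \theta|_\Gamma=0\}$ with norm $(\|\theta\|_{L^2}^2+\|T\theta\|_{L^2}^2)^{1/2}$, and $\mathcal{V}_\Gamma(\Omega)=\{\theta\in\mathcal{C}^\infty(\overline\Omega):\ \theta \text{ vanishes in a neighborhood of }\Gamma\}$. Then $\mathcal{V}_\Gamma(\Omega)\cap\mathcal{X}_\Gamma(\Omega)$ is dense in $\mathcal{X}_\Gamma(\Omega)$.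
   Context: Derivatives are in the sense of distributions. For $\theta\in L^2(\Omega)$ with $T\theta\in L^2(\Omega)$, $\theta$ has traces on $\{x=0\}$ in $H^{-1}(0,L_2)$ and on $\{y=0\}$ in $H^{-1}(0,L_1)$, and the condition $\theta|_\Gamma=0$ is understood in this sense. *)

theory Defs
  imports "HOL-Analysis.Analysis"
begin

definition Omega :: "real \<Rightarrow> real \<Rightarrow> (real \<times> real) set" where
  "Omega L1 L2 = {0<..<L1} \<times> {0<..<L2}"

definition Omega_cl :: "real \<Rightarrow> real \<Rightarrow> (real \<times> real) set" where
  "Omega_cl L1 L2 = {0..L1} \<times> {0..L2}"

definition Gamma :: "real \<Rightarrow> real \<Rightarrow> (real \<times> real) set" where
  "Gamma L1 L2 = ({0} \<times> {0..L2}) \<union> ({0..L1} \<times> {0})"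

definition px :: "(real \<times> real \<Rightarrow> real) \<Rightarrow> real \<times> real \<Rightarrow> real" where
  "px f p = deriv (\<lambda>x. f (x, snd p)) (fst p)"

definition py :: "(real \<times> real \<Rightarrow> real) \<Rightarrow> real \<times> real \<Rightarrow> real" where
  "py f p = deriv (\<lambda>y. f (fst p, y)) (snd p)"

definition Top :: "real \<Rightarrow> (real \<times> real \<Rightarrow> real) \<Rightarrow> real \<times> real \<Rightarrow> real" where
  "Top lam f p = py f p + lam * px f p"

fun Ck :: "nat \<Rightarrow> (real \<times> real \<Rightarrow> real) \<Rightarrow> bool" where
  "Ck 0 f = continuous_on UNIV f"
| "Ck (Suc n) f = ((\<forall>p. f differentiable (at p)) \<and> Ck n (px f) \<and> Ck n (py f))"

definition smooth2 :: "(real \<times> real \<Rightarrow> real) \<Rightarrow> bool" where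
  "smooth2 f \<longleftrightarrow> (\<forall>n. Ck n f)"

definition tsupp :: "(real \<times> real \<Rightarrow> real) \<Rightarrow> (real \<times> real) set" where
  "tsupp f = closure {p. f p \<noteq> 0}"

definition test_fun :: "(real \<times> real) set \<Rightarrow> (real \<times> real \<Rightarrow> real) \<Rightarrow> bool" where
  "test_fun S f \<longleftrightarrow> smooth2 f \<and> compact (tsupp f) \<and> tsupp f \<subseteq> S"

definition L2_on :: "(real \<times> real) set \<Rightarrow> (real \<times> real \<Rightarrow> real) \<Rightarrow> bool" where
  "L2_on S f \<longleftrightarrow> set_borel_measurable lborel S f \<and> set_integrable lborel S (\<lambda>p. (f p)\<^sup>2)"

definition weakT :: "real \<Rightarrow> real \<Rightarrow> real \<Rightarrow> (real \<times> real \<Rightarrow> real) \<Rightarrow> (real \<times> real \<Rightarrow> real) \<Rightarrow> bool" where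
  "weakT lam L1 L2 \<theta> g \<longleftrightarrow>
     (\<forall>\<phi>. test_fun (Omega L1 L2) \<phi> \<longrightarrow>
        (LINT p:Omega L1 L2|lborel. \<theta> p * Top lam \<phi> p) = - (LINT p:Omega L1 L2|lborel. g p * \<phi> p))"

text \<open>Vanishing of the trace of theta on Gamma_W = {x=0} in H^{-1}(0,L2), defined (as usual)
  through the Green formula: the trace is the functional
  phi(0,.) |-> integral over Omega of (T theta * phi + theta * T phi) (up to the factor -lambda),
  tested against smooth phi whose support meets the boundary only in the open side {0} x (0,L2).\<close>
definition trace_W_zero :: "real \<Rightarrow> real \<Rightarrow> real \<Rightarrow> (real \<times> real \<Rightarrow> real) \<Rightarrow> (real \<times> real \<Rightarrow> real) \<Rightarrow> bool" where
  "trace_W_zero lam L1 L2 \<theta> g \<longleftrightarrow>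
     (\<forall>\<phi>. test_fun ({..<L1} \<times> {0<..<L2}) \<phi> \<longrightarrow>
        (LINT p:Omega L1 L2|lborel. g p * \<phi> p + \<theta> p * Top lam \<phi> p) = 0)"

definition trace_S_zero :: "real \<Rightarrow> real \<Rightarrow> real \<Rightarrow> (real \<times> real \<Rightarrow> real) \<Rightarrow> (real \<times> real \<Rightarrow> real) \<Rightarrow> bool" where
  "trace_S_zero lam L1 L2 \<theta> g \<longleftrightarrow>
     (\<forall>\<phi>. test_fun ({0<..<L1} \<times> {..<L2}) \<phi> \<longrightarrow>
        (LINT p:Omega L1 L2|lborel. g p * \<phi> p + \<theta> p * Top lam \<phi> p) = 0)"

definition inX :: "real \<Rightarrow> real \<Rightarrow> real \<Rightarrow> (real \<times> real \<Rightarrow> real) \<Rightarrow> (real \<times> real \<Rightarrow> real) \<Rightarrow> bool" where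
  "inX lam L1 L2 \<theta> g \<longleftrightarrow> L2_on (Omega L1 L2) \<theta> \<and> L2_on (Omega L1 L2) g \<and> weakT lam L1 L2 \<theta> g
      \<and> trace_W_zero lam L1 L2 \<theta> g \<and> trace_S_zero lam L1 L2 \<theta> g"

text \<open>V_Gamma(Omega): C^infinity up to the boundary (restriction of a smooth function on the plane)
  and vanishing in a neighbourhood of Gamma.\<close>
definition inV :: "real \<Rightarrow> real \<Rightarrow> (real \<times> real \<Rightarrow> real) \<Rightarrow> bool" where
  "inV L1 L2 \<psi> \<longleftrightarrow> smooth2 \<psi> \<and>
     (\<exists>U. open U \<and> Gamma L1 L2 \<subseteq> U \<and> (\<forall>p\<in>U \<inter> Omega_cl L1 L2. \<psi> p = 0))"

definition Xdist :: "real \<Rightarrow> real \<Rightarrow> (real \<times> real \<Rightarrow> real) \<Rightarrow> (real \<times> real \<Rightarrow> real)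
     \<Rightarrow> (real \<times> real \<Rightarrow> real) \<Rightarrow> (real \<times> real \<Rightarrow> real) \<Rightarrow> real" where
  "Xdist L1 L2 \<theta> g \<psi> h = sqrt ((LINT p:Omega L1 L2|lborel. (\<theta> p - \<psi> p)\<^sup>2)
                               + (LINT p:Omega L1 L2|lborel. (g p - h p)\<^sup>2))"

end

theory Submission
  imports Defs "HOL-Computational_Algebra.Polynomial"
begin

text \<open>The vector field \<open>(\<lambda>, 1)\<close> of \<open>T\<close> points into \<open>\<Omega>\<close> along \<open>\<Gamma>\<close>. Let \<open>F\<close> and \<open>G\<close> be the extensions by
  zero of \<open>\<theta>\<close> and \<open>T \<theta>\<close>. The trace conditions, together with the fact that a point has
  zero capacity in the plane, say that \<open>T F = G\<close> holds weakly in \<open>(-\<infinity>, L1) \<times> (-\<infinity>, L2)\<close>. Convolve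
  with a mollifier supported in \<open>(d, 2d) \<times> (d, 2d)\<close>: the result \<open>\<psi>\<close> is smooth, vanishes where \<open>x < d\<close> or
  \<open>y < d\<close>, and the convolution at a point of \<open>\<Omega>\<close> only sees points to the lower left of it, so that
  \<open>T \<psi>\<close> is the convolution of \<open>G\<close> there. As \<open>d \<rightarrow> 0\<close> both convolutions converge in \<open>L\<^sup>2\<close>.\<close>

section \<open>Smooth functions on the plane\<close>

text \<open>No condition is imposed on the outflow sides x = L1 and y = L2, so the zero extension
  may jump there and \<open>T F = G\<close> can fail across them. A kernel centred at 0 would feel
  this jump from points near those sides, and would leave psi nonzero up to Gamma. Shifting the
  kernel into the open quadrant cures both at once, for every d > 0; the price is that the
  convolution averages translates of F, by vectors shorter than 4 d, so the L2 estimate rests on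
  continuity of translations. The corner is delicate because each trace condition tests only away
  from it, while the reflected kernel may cover it. A cutoff at scale 1 / n has a gradient whose L2
  norm stays bounded but does not tend to 0; the gain comes from the L2 mass of theta on the
  shrinking square. Smoothness is defined by iterated partial derivatives. The building blocks are
  therefore taken from families closed under differentiation: \<open>flat p\<close> for polynomials
  p, and convolutions with test functions.\<close>

definition flat :: "real poly \<Rightarrow> real \<Rightarrow> real" where
  "flat p x = (if x \<le> 0 then 0 else poly p (1 / x) * exp (- (1 / x)))"

lemma tendsto_poly_mult_exp_minus:
  fixes p :: "real poly"
  shows "((\<lambda>t. poly p t * exp (- t)) \<longlongrightarrow> 0) at_top"
proof -
  have "((\<lambda>t. \<Sum>i\<le>degree p. coeff p i * (t ^ i / exp t)) \<longlongrightarrow> (\<Sum>i\<le>degree p. coeff p i * 0)) at_top"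
    by (intro tendsto_intros tendsto_power_div_exp_0)
  then show ?thesis
    by (simp add: poly_altdef sum_distrib_right exp_minus divide_inverse mult.assoc)
qed

text \<open>With t = 1 / x one has d/dx = - t^2 d/dt, and d/dt of p(t) exp(-t) is (p' - p)(t)
  exp(-t). This explains the polynomial t^2 (p - p'), and why a polynomial parameter is carried
  along: the family is closed under differentiation, so smoothness becomes an induction.\<close>

lemma has_real_derivative_flat:
  "(flat p has_real_derivative flat ([:0, 0, 1:] * (p - pderiv p)) x) (at x)"
proof -
  consider "x < 0" | "x = 0" | "x > 0" by linarith
  then show ?thesis
  proof cases
    case 1
    have "((\<lambda>_. 0) has_real_derivative 0) (at x)" by simp
    then have "(flat p has_real_derivative 0) (at x)"
      by (rule has_field_derivative_transform_within_open[where S="{..<0}"])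
        (use 1 in \<open>auto simp: flat_def\<close>)
    with 1 show ?thesis by (simp add: flat_def)
  next
    case 2
    have "((\<lambda>y. flat p y / y) \<longlongrightarrow> 0) (at_right 0)"
    proof -
      \<comment> \<open>The difference quotient at 0 contributes one more factor 1 / y, which is the
        shift \<open>pCons 0 p\<close>.\<close>
      have "((\<lambda>y. poly (pCons 0 p) (inverse y) * exp (- inverse y)) \<longlongrightarrow> 0) (at_right 0)"
        by (rule filterlim_compose[OF tendsto_poly_mult_exp_minus filterlim_inverse_at_top_right])
      then show ?thesis
        by (rule Lim_transform_eventually)
          (auto simp: eventually_at_filter flat_def field_simps)
    qed
    moreover have "((\<lambda>y. flat p y / y) \<longlongrightarrow> 0) (at_left 0)"
      by (rule tendsto_eventually) (auto simp: eventually_at_filter flat_def)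
    ultimately have "((\<lambda>y. flat p y / y) \<longlongrightarrow> 0) (at 0)"
      by (simp add: filterlim_split_at)
    then show ?thesis
      using 2 by (simp add: has_field_derivative_iff flat_def)
  next
    case 3
    have "((\<lambda>x. poly p (1 / x) * exp (- (1 / x))) has_real_derivative
        flat ([:0, 0, 1:] * (p - pderiv p)) x) (at x)"
      using 3 by (auto intro!: derivative_eq_intros DERIV_chain2[OF poly_DERIV]
          simp: flat_def field_simps power2_eq_square)
    then show ?thesis
      by (rule has_field_derivative_transform_within_open[where S="{0<..}"])
        (use 3 in \<open>auto simp: flat_def\<close>)
  qed
qed

lemma continuous_flat: "continuous_on S (flat q)"
  using has_real_derivative_flat by (blast intro: DERIV_continuous_on has_field_derivative_at_within)

section \<open>Calculus for \<open>Ck\<close> and \<open>smooth2\<close>\<close>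

lemma Ck_Suc_imp_Ck: "Ck (Suc n) f \<Longrightarrow> Ck n f"
proof (induction n arbitrary: f)
  case 0
  then show ?case
    by (auto intro!: continuous_at_imp_continuous_on differentiable_imp_continuous_within)
next
  case (Suc n)
  from Suc.prems have "Ck n (px f)" "Ck n (py f)"
    by (auto intro!: Suc.IH simp del: Ck.simps(2) simp: Ck.simps(2)[of "Suc n"])
  with Suc.prems show ?case by simp
qed

lemma has_partial_derivatives:
  assumes "(f has_derivative f') (at p)"
  shows has_derivative_imp_px: "((\<lambda>x. f (x, snd p)) has_real_derivative f' (1, 0)) (at (fst p))"
    and has_derivative_imp_py: "((\<lambda>y. f (fst p, y)) has_real_derivative f' (0, 1)) (at (snd p))"
    and px_eq: "px f p = f' (1, 0)" and py_eq: "py f p = f' (0, 1)"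
proof -
  interpret bounded_linear f' using assms by (rule has_derivative_bounded_linear)
  have *: "(\<lambda>h. f' (h, 0)) = (*) (f' (1, 0))" "(\<lambda>h. f' (0, h)) = (*) (f' (0, 1))"
    using scaleR[where b="(1, 0)"] scaleR[where b="(0, 1)"]
    by (intro ext; metis mult.commute mult.right_neutral mult_zero_right real_scaleR_def scaleR_Pair)+
  have "((\<lambda>x. f (x, snd p)) has_derivative (\<lambda>h. f' (h, 0))) (at (fst p))"
    using has_derivative_compose[of "\<lambda>x. (x, snd p)" "\<lambda>h. (h, 0)" "fst p" UNIV f f'] assms
    by (simp add: has_derivative_Pair)
  then show 1: "((\<lambda>x. f (x, snd p)) has_real_derivative f' (1, 0)) (at (fst p))"
    unfolding has_field_derivative_def * .
  have "((\<lambda>y. f (fst p, y)) has_derivative (\<lambda>h. f' (0, h))) (at (snd p))"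
    using has_derivative_compose[of "\<lambda>y. (fst p, y)" "\<lambda>h. (0, h)" "snd p" UNIV f f'] assms
    by (simp add: has_derivative_Pair)
  then show 2: "((\<lambda>y. f (fst p, y)) has_real_derivative f' (0, 1)) (at (snd p))"
    unfolding has_field_derivative_def * .
  show "px f p = f' (1, 0)" "py f p = f' (0, 1)"
    using 1 2 by (auto simp: px_def py_def DERIV_imp_deriv)
qed

lemma has_derivative_px_py:
  assumes "f differentiable (at p)"
  shows "(f has_derivative (\<lambda>h. px f p * fst h + py f p * snd h)) (at p)"
proof -
  obtain f' where f': "(f has_derivative f') (at p)"
    using assms by (auto simp: differentiable_def)
  interpret bounded_linear f' using f' by (rule has_derivative_bounded_linear)
  have "f' h = px f p * fst h + py f p * snd h" for h
    using scaleR[of "fst h" "(1, 0)"] scaleR[of "snd h" "(0, 1)"] add[of "(fst h, 0)" "(0, snd h)"]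
    by (simp add: px_eq[OF f'] py_eq[OF f'] mult.commute)
  then show ?thesis using f' by presburger
qed

text \<open>Uniqueness of derivatives identifies \<open>px f\<close> and \<open>py f\<close> with
  the candidates, so a closed form of the total derivative is enough to climb one order.\<close>

lemma Ck_SucI:
  assumes "\<And>p. (f has_derivative (\<lambda>h. a p * fst h + b p * snd h)) (at p)" "Ck n a" "Ck n b"
  shows "Ck (Suc n) f"
proof -
  have "px f = a" "py f = b"
    using px_eq[OF assms(1)] py_eq[OF assms(1)] by auto
  then show ?thesis using assms by (auto simp: differentiable_def)
qed

lemma Ck_const [simp]: "Ck n (\<lambda>_. c)"
proof (induction n arbitrary: c)
  case (Suc n)
  show ?case by (rule Ck_SucI[of _ "\<lambda>_. 0" "\<lambda>_. 0"]) (use Suc in auto)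
qed simp

lemma px_mult:
  assumes "f differentiable (at p)" "g differentiable (at p)"
  shows "px (\<lambda>p. f p * g p) p = px f p * g p + f p * px g p"
    and "py (\<lambda>p. f p * g p) p = py f p * g p + f p * py g p"
  by (simp_all add: px_eq[OF has_derivative_mult[OF assms[THEN has_derivative_px_py]]]
    py_eq[OF has_derivative_mult[OF assms[THEN has_derivative_px_py]]])

lemma px_add:
  assumes "f differentiable (at p)" "g differentiable (at p)"
  shows "px (\<lambda>p. f p + g p) p = px f p + px g p"
    and "py (\<lambda>p. f p + g p) p = py f p + py g p"
  by (simp_all add: px_eq[OF has_derivative_add[OF assms[THEN has_derivative_px_py]]]
    py_eq[OF has_derivative_add[OF assms[THEN has_derivative_px_py]]])

lemma Ck_add: "Ck n f \<Longrightarrow> Ck n g \<Longrightarrow> Ck n (\<lambda>p. f p + g p)"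
proof (induction n arbitrary: f g)
  case 0 then show ?case by (simp add: continuous_on_add)
next
  case (Suc n)
  then have "px (\<lambda>p. f p + g p) = (\<lambda>p. px f p + px g p)" "py (\<lambda>p. f p + g p) = (\<lambda>p. py f p + py g p)"
    by (auto simp: px_add)
  with Suc show ?case by auto
qed

lemma Ck_mult: "Ck n f \<Longrightarrow> Ck n g \<Longrightarrow> Ck n (\<lambda>p. f p * g p)"
proof (induction n arbitrary: f g)
  case 0 then show ?case by (simp add: continuous_on_mult)
next
  case (Suc n)
  then have "px (\<lambda>p. f p * g p) = (\<lambda>p. px f p * g p + f p * px g p)"
    "py (\<lambda>p. f p * g p) = (\<lambda>p. py f p * g p + f p * py g p)"
    by (auto simp: px_mult)
  with Suc Ck_Suc_imp_Ck[OF Suc.prems(1)] Ck_Suc_imp_Ck[OF Suc.prems(2)] show ?case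
    by (auto intro!: Ck_add)
qed

lemma smooth2_const [simp]: "smooth2 (\<lambda>_. c)"
  by (simp add: smooth2_def)

lemma smooth2_add: "smooth2 f \<Longrightarrow> smooth2 g \<Longrightarrow> smooth2 (\<lambda>p. f p + g p)"
  by (simp add: smooth2_def Ck_add)

lemma smooth2_mult: "smooth2 f \<Longrightarrow> smooth2 g \<Longrightarrow> smooth2 (\<lambda>p. f p * g p)"
  by (simp add: smooth2_def Ck_mult)

lemma smooth2D:
  assumes "smooth2 f"
  shows smooth2_px: "smooth2 (px f)" and smooth2_py: "smooth2 (py f)"
    and smooth2_differentiable: "f differentiable (at p)"
    and smooth2_continuous: "continuous_on UNIV f"
proof -
  have *: "Ck (Suc n) f" for n using assms unfolding smooth2_def ..
  from * show "smooth2 (px f)" "smooth2 (py f)"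
    by (simp_all add: smooth2_def)
  from *[of 0] show "f differentiable (at p)" by (cases p) simp
  have "Ck 0 f" using assms unfolding smooth2_def ..
  then show "continuous_on UNIV f" by simp
qed

text \<open>By the chain rule both partial derivatives are constant multiples of \<open>f'\<close>
  composed with the same affine form, so these composites also reproduce themselves under
  differentiation.\<close>

lemma Ck_affine_Suc:
  fixes f f' :: "real \<Rightarrow> real"
  assumes "\<And>x. (f has_real_derivative f' x) (at x)"
    and "Ck n (\<lambda>p. f' (a * fst p + b * snd p + c))"
  shows "Ck (Suc n) (\<lambda>p. f (a * fst p + b * snd p + c))"
proof (rule Ck_SucI)
  show "((\<lambda>p. f (a * fst p + b * snd p + c)) has_derivative
      (\<lambda>h. (a * f' (a * fst p + b * snd p + c)) * fst h + (b * f' (a * fst p + b * snd p + c)) * snd h)) (at p)" for p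
    by (rule has_derivative_eq_rhs, rule DERIV_compose_FDERIV[OF assms(1)], 
      auto intro!: derivative_eq_intros simp: algebra_simps)
qed (intro Ck_mult Ck_const assms(2))+

lemma smooth2_affine:
  fixes f f' :: "real \<Rightarrow> real"
  assumes "\<And>x. (f has_real_derivative f' x) (at x)"
    and "smooth2 (\<lambda>p. f' (a * fst p + b * snd p + c))"
  shows "smooth2 (\<lambda>p. f (a * fst p + b * snd p + c))"
  unfolding smooth2_def
proof
  show "Ck n (\<lambda>p. f (a * fst p + b * snd p + c))" for n
    by (rule Ck_Suc_imp_Ck, rule Ck_affine_Suc[OF assms(1)]) (use assms(2) in \<open>simp add: smooth2_def\<close>)
qed

lemma smooth2_flat: "smooth2 (\<lambda>p. flat q (a * fst p + b * snd p + c))"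
proof -
  have "continuous_on UNIV (\<lambda>p. flat q (a * fst p + b * snd p + c))" for q
    by (rule continuous_on_compose2[OF continuous_flat[of UNIV]]) (auto intro!: continuous_intros)
  then have "Ck n (\<lambda>p. flat q (a * fst p + b * snd p + c))" for n
  proof (induction n arbitrary: q)
    case (Suc n)
    show ?case by (rule Ck_affine_Suc[OF has_real_derivative_flat Suc.IH[OF Suc.prems]])
  qed simp
  then show ?thesis by (simp add: smooth2_def)
qed

section \<open>A mollifier supported strictly inside the first quadrant\<close>

text \<open>The interval (1, 2) lies to one side of 0; after rescaling this makes the mollifier
  one-sided.\<close>

definition bump :: "real \<Rightarrow> real" where
  "bump t = flat 1 (t - 1) * flat 1 (2 - t)"

lemma bump_nonneg: "0 \<le> bump t"
  and bump_pos: "1 < t \<Longrightarrow> t < 2 \<Longrightarrow> 0 < bump t"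
  and bump_eq_0: "t \<le> 1 \<or> 2 \<le> t \<Longrightarrow> bump t = 0"
  by (auto simp: bump_def flat_def)

lemma continuous_bump: "continuous_on S bump"
  unfolding bump_def[abs_def]
  by (intro continuous_intros continuous_on_compose2[OF continuous_flat[of UNIV]]) auto

text \<open>Only differences of its values are used below, so any choice of primitive will do. It
  provides both the normalising constant of the kernel and the cutoff \<open>step\<close>.\<close>

definition bump_primitive :: "real \<Rightarrow> real" where
  "bump_primitive = (SOME B. \<forall>x. (B has_real_derivative bump x) (at x))"

lemma DERIV_bump_primitive: "(bump_primitive has_real_derivative bump x) (at x)"
proof -
  obtain B where "\<And>x. (B has_vector_derivative bump x) (at x)"
    using einterval_antiderivative[of "-\<infinity>" "\<infinity>" bump] continuous_bump[of UNIV]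
    by (auto simp: continuous_on_eq_continuous_at)
  then have "\<exists>B. \<forall>x. (B has_real_derivative bump x) (at x)"
    by (auto simp: has_real_derivative_iff_has_vector_derivative)
  from someI_ex[OF this] show ?thesis
    unfolding bump_primitive_def[symmetric] by blast
qed

lemma bump_primitive_less: "bump_primitive 1 < bump_primitive 2"
proof -
  obtain z where "1 < z" "z < 2" "bump_primitive 2 - bump_primitive 1 = (2 - 1) * bump z"
    using MVT2[of 1 2 bump_primitive bump] DERIV_bump_primitive by auto
  then show ?thesis using bump_pos[of z] by simp
qed

definition kern :: "real \<Rightarrow> real" where
  "kern t = bump t / (bump_primitive 2 - bump_primitive 1)"

text \<open>The primitive of \<open>kern\<close> that rises from 0 at t = 1 to 1 at t = 2: the
  cutoff used at the corner, with derivative supported between 1 and 2.\<close>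

definition step :: "real \<Rightarrow> real" where
  "step t = (bump_primitive t - bump_primitive 1) / (bump_primitive 2 - bump_primitive 1)"

lemma DERIV_step: "(step has_real_derivative kern x) (at x)"
  unfolding step_def[abs_def] kern_def
  using bump_primitive_less by (auto intro!: derivative_eq_intros DERIV_bump_primitive)

lemma kern_nonneg: "0 \<le> kern t"
  and kern_eq_0: "t \<le> 1 \<or> 2 \<le> t \<Longrightarrow> kern t = 0"
  using bump_primitive_less bump_nonneg[of t] bump_eq_0[of t] by (auto simp: kern_def)

lemma step_mono: "x \<le> y \<Longrightarrow> step x \<le> step y"
  using DERIV_nonneg_imp_nondecreasing DERIV_step kern_nonneg by metis

lemma step_eq_0: "t \<le> 1 \<Longrightarrow> step t = 0"
proof (cases "t = 1")
  case False
  assume "t \<le> 1"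
  with False have "t < 1" by simp
  then obtain z where z: "z < 1" "step 1 - step t = (1 - t) * kern z"
    using MVT2[of t 1 step kern] DERIV_step by auto
  moreover have "step 1 = 0" by (simp add: step_def)
  ultimately show ?thesis by (simp add: kern_eq_0)
qed (simp add: step_def)

lemma step_eq_1: "2 \<le> t \<Longrightarrow> step t = 1"
proof (cases "t = 2")
  case False
  assume "2 \<le> t"
  with False have "2 < t" by simp
  then obtain z where z: "2 < z" "step t - step 2 = (t - 2) * kern z"
    using MVT2[of 2 t step kern] DERIV_step by auto
  moreover have "step 2 = 1" using bump_primitive_less by (simp add: step_def)
  ultimately show ?thesis by (simp add: kern_eq_0)
qed (use bump_primitive_less in \<open>simp add: step_def\<close>)

lemma step_bounds: "0 \<le> step t" "step t \<le> 1"
  using step_mono[of 1 t] step_eq_0[of t] step_eq_0[of 1] step_mono[of t 2] step_eq_1[of t] step_eq_1[of 2]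
  by linarith+

lemma continuous_kern: "continuous_on S kern"
  unfolding kern_def[abs_def] using bump_primitive_less by (auto intro!: continuous_intros continuous_bump)

lemma kern_bounded: obtains M where "M > 0" "\<And>t. kern t \<le> M"
proof -
  have "compact (kern ` {1..2})"
    by (intro compact_continuous_image continuous_kern) simp
  then obtain M where M: "\<And>t. t \<in> {1..2} \<Longrightarrow> \<bar>kern t\<bar> \<le> M"
    using compact_imp_bounded[of "kern ` {1..2}"] unfolding bounded_iff by fastforce
  have "kern t \<le> \<bar>M\<bar> + 1" for t
    using M[of t] kern_eq_0[of t] by (cases "t \<in> {1..2}") auto
  then show ?thesis by (intro that[of "\<bar>M\<bar> + 1"]) auto
qed

lemma has_bochner_integral_kern: "has_bochner_integral lborel kern 1"
proof -
  have "has_bochner_integral lborel (\<lambda>x. kern x * indicator {1..2} x) (step 2 - step 1)"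
    by (rule has_bochner_integral_FTC_Icc_real)
      (use DERIV_step continuous_kern[of UNIV] in \<open>auto simp: continuous_on_eq_continuous_at\<close>)
  moreover have "kern x * indicator {1..2} x = kern x" for x
    using kern_eq_0[of x] by (cases "x \<in> {1..2}") auto
  ultimately show ?thesis by (simp add: step_eq_0 step_eq_1)
qed

lemma smooth2_kern: "smooth2 (\<lambda>p. kern (a * fst p + b * snd p + c))"
proof -
  have 1: "smooth2 (\<lambda>p. flat 1 (a * fst p + b * snd p + (c - 1)))"
    by (rule smooth2_flat)
  have 2: "smooth2 (\<lambda>p. flat 1 ((-a) * fst p + (-b) * snd p + (2 - c)))"
    by (rule smooth2_flat)
  show ?thesis
    using smooth2_mult[OF smooth2_mult[OF 1 2] smooth2_const[of "1 / (bump_primitive 2 - bump_primitive 1)"]]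
    by (simp add: kern_def[abs_def] bump_def[abs_def] algebra_simps)
qed

lemma smooth2_step: "smooth2 (\<lambda>p. step (a * fst p + b * snd p + c))"
  by (rule smooth2_affine[OF DERIV_step smooth2_kern])

text \<open>The factor 1 / d^2 keeps the mass equal to 1 under rescaling in the plane.\<close>

definition kern2 :: "real \<Rightarrow> real \<times> real \<Rightarrow> real" where
  "kern2 d z = kern (fst z / d) * kern (snd z / d) / d\<^sup>2"

lemma kern2_nonneg: "0 \<le> kern2 d z"
  by (simp add: kern2_def kern_nonneg)

lemma kern2_eq_0: 
  assumes "d > 0" "fst z \<le> d \<or> 2 * d \<le> fst z \<or> snd z \<le> d \<or> 2 * d \<le> snd z"
  shows "kern2 d z = 0"
proof -
  have "fst z / d \<le> 1 \<or> 2 \<le> fst z / d \<or> snd z / d \<le> 1 \<or> 2 \<le> snd z / d"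
    using assms by (simp add: field_simps)
  then show ?thesis unfolding kern2_def using kern_eq_0 by auto
qed

text \<open>The free slopes cover the kernel itself (slopes 1) and its reflection q -> p - q (slopes
  -1).\<close>

lemma smooth2_kern2_affine: "smooth2 (\<lambda>q. kern2 d (c1 + a * fst q, c2 + b * snd q))"
proof -
  have "smooth2 (\<lambda>q. kern ((a/d) * fst q + 0 * snd q + (c1/d)) * kern (0 * fst q + (b/d) * snd q + (c2/d)) * (1 / d\<^sup>2))"
    by (intro smooth2_mult smooth2_kern smooth2_const)
  then show ?thesis by (simp add: kern2_def add_divide_distrib algebra_simps)
qed

lemma has_bochner_integral_kern2:
  assumes "d > 0"
  shows "has_bochner_integral lborel (kern2 d) 1"
proof -
  \<comment> \<open>The one-dimensional factor: \<open>kern2 d\<close> is the tensor product of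
    \<open>h\<close> with itself, and \<open>h\<close> has mass 1 by substitution.\<close>
  define h where "h x = kern (x / d) / d" for x
  have "has_bochner_integral lborel (\<lambda>x. kern (0 + (1/d) * x)) (1 /\<^sub>R \<bar>1/d\<bar>)"
    using assms has_bochner_integral_kern by (subst lborel_has_bochner_integral_real_affine_iff[symmetric]) auto
  from has_bochner_integral_divide_zero[OF this, of d]
  have h: "integrable lborel h" "integral\<^sup>L lborel h = 1"
    using assms by (simp_all add: has_bochner_integral_iff h_def[abs_def])
  have [simp]: "\<bar>h x\<bar> = h x" for x
    using assms by (simp add: h_def kern_nonneg)
  have [measurable]: "h \<in> borel_measurable borel"
    using h(1) by auto
  have i: "integrable (lborel \<Otimes>\<^sub>M lborel) (\<lambda>(x, y). h x * h y)"
    using h by (intro lborel_pair.Fubini_integrable) (auto simp: abs_mult)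
  have "(\<integral>x. \<integral>y. h x * h y \<partial>lborel \<partial>lborel) = 1"
    using h by simp
  with lborel_pair.integral_fst[OF i] i
  have "has_bochner_integral lborel (\<lambda>(x, y). h x * h y) 1"
    by (simp add: has_bochner_integral_iff lborel_prod)
  then show ?thesis
    by (simp add: h_def kern2_def[abs_def] case_prod_unfold power2_eq_square)
qed

section \<open>Test functions\<close>

lemma smooth2_measurable: "smooth2 f \<Longrightarrow> f \<in> borel_measurable borel"
  by (intro borel_measurable_continuous_onI smooth2_continuous)

lemma test_fun_bounded:
  assumes "test_fun S f"
  obtains M where "M > 0" "\<And>p. \<bar>f p\<bar> \<le> M"
proof -
  have "compact (f ` tsupp f)"
    using assms by (intro compact_continuous_image continuous_on_subset[OF smooth2_continuous])
      (auto simp: test_fun_def)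
  then have "bounded (f ` tsupp f)" by (rule compact_imp_bounded)
  then obtain M where M: "\<forall>x\<in>f ` tsupp f. norm x \<le> M"
    unfolding bounded_iff by blast
  have "\<bar>f p\<bar> \<le> \<bar>M\<bar> + 1" for p
  proof (cases "f p = 0")
    case False
    then have "p \<in> tsupp f" unfolding tsupp_def by (intro subsetD[OF closure_subset]) simp
    then show ?thesis using M by force
  qed simp
  then show ?thesis by (intro that[of "\<bar>M\<bar> + 1"]) auto
qed

lemma not_in_tsupp: "p \<notin> tsupp f \<Longrightarrow> f p = 0"
  unfolding tsupp_def using closure_subset[of "{p. f p \<noteq> 0}"] by auto

lemma px_not_in_tsupp:
  assumes "p \<notin> tsupp f"
  shows "px f p = 0" "py f p = 0"
proof -
  have "open (- tsupp f)" by (simp add: tsupp_def open_Compl)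
  then have "(f has_derivative (\<lambda>_. 0)) (at p)"
    by (rule has_derivative_transform_within_open[rotated 1, where f="\<lambda>_. 0"])
      (use assms in \<open>auto simp: not_in_tsupp\<close>)
  from px_eq[OF this] py_eq[OF this] show "px f p = 0" "py f p = 0" by simp_all
qed

lemma tsupp_px: "tsupp (px f) \<subseteq> tsupp f" "tsupp (py f) \<subseteq> tsupp f"
proof -
  have "closed (tsupp f)" by (simp add: tsupp_def)
  then show "tsupp (px f) \<subseteq> tsupp f" "tsupp (py f) \<subseteq> tsupp f"
    unfolding tsupp_def[of "px f"] tsupp_def[of "py f"]
    using px_not_in_tsupp[of _ f] by (intro closure_minimal subsetI; force)+
qed

lemma test_fun_px:
  assumes "test_fun S f"
  shows "test_fun S (px f)" "test_fun S (py f)"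
proof -
  have "compact (tsupp g)" if "tsupp g \<subseteq> tsupp f" for g
    using assms that closed_Int_compact[of "tsupp g" "tsupp f"]
    by (simp add: test_fun_def tsupp_def Int_absorb2)
  then show "test_fun S (px f)" "test_fun S (py f)"
    using assms tsupp_px[of f] by (auto simp: test_fun_def smooth2_px smooth2_py)
qed

lemma test_fun_UNIV: "test_fun S f \<Longrightarrow> test_fun UNIV f"
  by (simp add: test_fun_def)

lemma test_funI:
  assumes "smooth2 f" "closed C" "bounded C" "C \<subseteq> S" "\<And>p. p \<notin> C \<Longrightarrow> f p = 0"
  shows "test_fun S f"
proof -
  have "tsupp f \<subseteq> C"
    unfolding tsupp_def by (intro closure_minimal assms(2)) (use assms(5) in auto)
  then show ?thesis
    using assms bounded_subset[of C "tsupp f"]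
    by (auto simp: test_fun_def compact_eq_bounded_closed) (simp add: tsupp_def)
qed

lemma onorm_affine_le: "onorm (\<lambda>h::real \<times> real. a * fst h + b * snd h) \<le> \<bar>a\<bar> + \<bar>b\<bar>"
proof (rule onorm_le)
  fix h :: "real \<times> real"
  have "\<bar>a * fst h + b * snd h\<bar> \<le> \<bar>a\<bar> * \<bar>fst h\<bar> + \<bar>b\<bar> * \<bar>snd h\<bar>"
    by (metis abs_mult abs_triangle_ineq)
  also have "\<dots> \<le> \<bar>a\<bar> * norm h + \<bar>b\<bar> * norm h"
    using norm_fst_le[of "fst h" "snd h"] norm_snd_le[of "snd h" "fst h"] by (intro add_mono mult_left_mono) auto
  finally show "norm (a * fst h + b * snd h) \<le> (\<bar>a\<bar> + \<bar>b\<bar>) * norm h"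
    by (simp add: algebra_simps)
qed

lemma test_fun_lipschitz:
  assumes "test_fun S f"
  obtains M where "M > 0" "\<And>p q. \<bar>f p - f q\<bar> \<le> M * norm (p - q)"
proof -
  obtain A where A: "A > 0" "\<And>p. \<bar>px f p\<bar> \<le> A" using test_fun_bounded[OF test_fun_px(1)[OF assms]] by blast
  obtain B where B: "B > 0" "\<And>p. \<bar>py f p\<bar> \<le> B" using test_fun_bounded[OF test_fun_px(2)[OF assms]] by blast
  have "norm (f p - f q) \<le> (A + B) * norm (p - q)" for p q
  proof (rule differentiable_bound[of UNIV])
    show "(f has_derivative (\<lambda>h. px f x * fst h + py f x * snd h)) (at x within UNIV)" for x
      using assms by (simp add: test_fun_def has_derivative_px_py smooth2_differentiable)
    show "onorm (\<lambda>h. px f x * fst h + py f x * snd h) \<le> A + B" for x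
      using onorm_affine_le[of "px f x" "py f x"] A(2)[of x] B(2)[of x] by linarith
  qed auto
  then show ?thesis using A(1) B(1) by (intro that[of "A + B"]) auto
qed

text \<open>The partial derivatives are again test functions, hence Lipschitz, so the derivative
  varies by at most (A + B) |h| on the ball of radius |h|. The constant is uniform in p, which
  allows differentiation under the integral sign by a direct estimate.\<close>

lemma test_fun_taylor:
  assumes "test_fun S f"
  obtains M where "M > 0"
    "\<And>p h. \<bar>f (p + h) - f p - (px f p * fst h + py f p * snd h)\<bar> \<le> M * (norm h)\<^sup>2"
proof -
  obtain A where A: "A > 0" "\<And>p q. \<bar>px f p - px f q\<bar> \<le> A * norm (p - q)"
    using test_fun_lipschitz[OF test_fun_px(1)[OF assms]] by blast
  obtain B where B: "B > 0" "\<And>p q. \<bar>py f p - py f q\<bar> \<le> B * norm (p - q)"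
    using test_fun_lipschitz[OF test_fun_px(2)[OF assms]] by blast
  have "norm (f (p + h) - f p - (px f p * fst (p + h - p) + py f p * snd (p + h - p)))
      \<le> norm (p + h - p) * ((A + B) * norm h)" for p h
  proof (rule differentiable_bound_linearization[where S="cball p (norm h)" and
        f'="\<lambda>x h. px f x * fst h + py f x * snd h"])
    show "p + t *\<^sub>R (p + h - p) \<in> cball p (norm h)" if "t \<in> {0..1}" for t
      using that by (simp add: dist_norm mult_left_le_one_le)
    show "(f has_derivative (\<lambda>h. px f x * fst h + py f x * snd h)) (at x within cball p (norm h))" for x
      using assms by - (rule has_derivative_at_withinI, simp add: test_fun_def has_derivative_px_py smooth2_differentiable)
    show "onorm ((\<lambda>h. px f x * fst h + py f x * snd h) - (\<lambda>h. px f p * fst h + py f p * snd h)) \<le> (A + B) * norm h"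
      if x: "x \<in> cball p (norm h)" for x
    proof -
      have "onorm ((\<lambda>h. px f x * fst h + py f x * snd h) - (\<lambda>h. px f p * fst h + py f p * snd h))
         = onorm (\<lambda>h::real\<times>real. (px f x - px f p) * fst h + (py f x - py f p) * snd h)"
        by (simp add: fun_diff_def algebra_simps)
      also have "\<dots> \<le> \<bar>px f x - px f p\<bar> + \<bar>py f x - py f p\<bar>" by (rule onorm_affine_le)
      also have "\<dots> \<le> (A + B) * norm (x - p)" using A(2)[of x p] B(2)[of x p] by (simp add: algebra_simps)
      also have "\<dots> \<le> (A + B) * norm h" using x A B by (intro mult_left_mono) (auto simp: dist_norm norm_minus_commute)
      finally show ?thesis .
    qed
  qed auto
  then show ?thesis using A(1) B(1) by (intro that[of "A + B"]) (auto simp: power2_eq_square mult_ac)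
qed

section \<open>Convolution\<close>

definition convol :: "(real \<times> real \<Rightarrow> real) \<Rightarrow> (real \<times> real \<Rightarrow> real) \<Rightarrow> real \<times> real \<Rightarrow> real" where
  "convol F K p = (\<integral>q. F q * K (p - q) \<partial>lborel)"

lemma integrable_mult_bounded_real:
  fixes F h :: "'a \<Rightarrow> real"
  assumes "integrable M F" "h \<in> borel_measurable M" "\<And>q. \<bar>h q\<bar> \<le> C"
  shows "integrable M (\<lambda>q. F q * h q)"
proof (rule Bochner_Integration.integrable_bound)
  show "integrable M (\<lambda>q. C * F q)" using assms by simp
  show "AE x in M. norm (F x * h x) \<le> norm (C * F x)"
  proof (intro AE_I2)
    fix x
    have "\<bar>h x\<bar> \<le> \<bar>C\<bar>" using assms(3)[of x] by simp
    then show "norm (F x * h x) \<le> norm (C * F x)"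
      using mult_left_mono[of "\<bar>h x\<bar>" "\<bar>C\<bar>" "\<bar>F x\<bar>"] by (simp add: abs_mult mult.commute)
  qed
qed (use assms in auto)

lemma smooth2_measurable_minus [measurable]: "smooth2 K \<Longrightarrow> (\<lambda>q. K (p - q)) \<in> borel_measurable borel"
  by (rule measurable_compose[OF _ smooth2_measurable]) auto

lemma integrable_convol:
  assumes "integrable lborel F" "test_fun S K"
  shows "integrable lborel (\<lambda>q. F q * K (p - q))"
proof -
  obtain C where "\<And>p. \<bar>K p\<bar> \<le> C" using test_fun_bounded[OF assms(2)] by blast
  then show ?thesis
    using assms by (intro integrable_mult_bounded_real[where C=C])
      (auto simp: test_fun_def)
qed

text \<open>Integrating the uniform Taylor remainder of K against |F| bounds the error by M |h|^2
  times the L1 norm of F. All derivatives fall on K, so F need only be integrable.\<close>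

lemma has_derivative_convol:
  assumes F: "integrable lborel F" and K: "test_fun S K"
  shows "(convol F K has_derivative (\<lambda>h. convol F (px K) p * fst h + convol F (py K) p * snd h)) (at p)"
proof -
  obtain M where M: "M > 0"
    "\<And>p h. \<bar>K (p + h) - K p - (px K p * fst h + py K p * snd h)\<bar> \<le> M * (norm h)\<^sup>2"
    using test_fun_taylor[OF K] by blast
  note i = integrable_convol[OF F K] integrable_convol[OF F test_fun_px(1)[OF K]]
    integrable_convol[OF F test_fun_px(2)[OF K]]
  define I where "I = (\<integral>q. \<bar>F q\<bar> \<partial>lborel)"
  have I: "I \<ge> 0" by (simp add: I_def)
  have est: "\<bar>convol F K (p + h) - convol F K p - (convol F (px K) p * fst h + convol F (py K) p * snd h)\<bar>
      \<le> M * (norm h)\<^sup>2 * I" for h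
  proof -
    have "convol F K (p + h) - convol F K p - (convol F (px K) p * fst h + convol F (py K) p * snd h)
        = (\<integral>q. F q * K (p + h - q) - F q * K (p - q)
            - (F q * px K (p - q) * fst h + F q * py K (p - q) * snd h) \<partial>lborel)"
      unfolding convol_def using i by simp
    also have "\<dots> = (\<integral>q. F q * (K ((p - q) + h) - K (p - q)
            - (px K (p - q) * fst h + py K (p - q) * snd h)) \<partial>lborel)"
      by (simp add: algebra_simps)
    finally have eq: "convol F K (p + h) - convol F K p - (convol F (px K) p * fst h + convol F (py K) p * snd h)
        = (\<integral>q. F q * (K ((p - q) + h) - K (p - q)
            - (px K (p - q) * fst h + py K (p - q) * snd h)) \<partial>lborel)" .
    have "\<bar>\<integral>q. F q * (K ((p - q) + h) - K (p - q)
            - (px K (p - q) * fst h + py K (p - q) * snd h)) \<partial>lborel\<bar> \<le> (\<integral>q. \<bar>F q\<bar> * (M * (norm h)\<^sup>2) \<partial>lborel)"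
    proof (rule order_trans[OF integral_abs_bound integral_mono'])
      show "integrable lborel (\<lambda>q. \<bar>F q\<bar> * (M * (norm h)\<^sup>2))" using F by simp
      show "\<bar>F q * (K ((p - q) + h) - K (p - q)
            - (px K (p - q) * fst h + py K (p - q) * snd h))\<bar> \<le> \<bar>F q\<bar> * (M * (norm h)\<^sup>2)" for q
        unfolding abs_mult by (intro mult_left_mono M(2)) simp
    qed (use M(1) in simp)
    also have "\<dots> = M * (norm h)\<^sup>2 * I" by (simp add: I_def)
    finally show ?thesis unfolding eq .
  qed
  show ?thesis
    unfolding has_derivative_at
  proof (intro conjI)
    show "bounded_linear (\<lambda>h. convol F (px K) p * fst h + convol F (py K) p * snd h)"
      by (intro bounded_linear_add bounded_linear_compose[OF bounded_linear_mult_right] bounded_linear_fst bounded_linear_snd)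
    have "((\<lambda>h. M * I * norm (h :: real \<times> real)) \<longlongrightarrow> 0) (at 0)"
      by (rule tendsto_eq_intros refl tendsto_norm_zero tendsto_ident_at | simp)+
    then show "(\<lambda>h. norm (convol F K (p + h) - convol F K p
        - (convol F (px K) p * fst h + convol F (py K) p * snd h)) / norm h) \<midarrow>0\<rightarrow> 0"
    proof (rule Lim_null_comparison[rotated])
      show "\<forall>\<^sub>F h in at 0. norm (norm (convol F K (p + h) - convol F K p
        - (convol F (px K) p * fst h + convol F (py K) p * snd h)) / norm h) \<le> M * I * norm h"
        using est by (auto simp: eventually_at_filter field_simps power2_eq_square)
    qed
  qed
qed

text \<open>The partial derivatives of the convolution are convolutions of the same F with other
  test functions; hence the induction over arbitrary K.\<close>

lemma Ck_convol:
  assumes F: "integrable lborel F"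
  shows "test_fun S K \<Longrightarrow> Ck n (convol F K)"
proof (induction n arbitrary: K)
  case 0
  show ?case
    using has_derivative_convol[OF F 0] by (auto intro!: continuous_at_imp_continuous_on has_derivative_continuous)
next
  case (Suc n)
  show ?case
    by (rule Ck_SucI[OF has_derivative_convol[OF F Suc.prems]]) (intro Suc.IH test_fun_px Suc.prems)+
qed

lemma smooth2_convol: "integrable lborel F \<Longrightarrow> test_fun S K \<Longrightarrow> smooth2 (convol F K)"
  by (simp add: smooth2_def Ck_convol)

lemma Top_convol:
  assumes F: "integrable lborel F" and K: "test_fun S K"
  shows "Top lam (convol F K) p = convol F (Top lam K) p"
proof -
  have "convol F (Top lam K) p = (\<integral>q. F q * py K (p - q) + lam * (F q * px K (p - q)) \<partial>lborel)"
    by (simp add: convol_def Top_def algebra_simps)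
  also have "\<dots> = convol F (py K) p + lam * convol F (px K) p"
    unfolding convol_def
    using integrable_convol[OF F test_fun_px(1)[OF K]] integrable_convol[OF F test_fun_px(2)[OF K]] by simp
  finally show ?thesis
    using px_eq[OF has_derivative_convol[OF assms]] py_eq[OF has_derivative_convol[OF assms]]
    by (simp add: Top_def)
qed

section \<open>Approximation in mean square\<close>

lemma lborel_distr_diff_left:
  fixes t :: "'a::euclidean_space"
  shows "distr lborel borel (\<lambda>x. t - x) = lborel"
  using lborel_affine[of "-1" t] by (simp add: density_1)

lemma lborel_distr_diff_right:
  fixes z :: "'a::euclidean_space"
  shows "distr lborel borel (\<lambda>x. x - z) = lborel"
proof -
  have "(\<lambda>x. x - z) = (+) (- z)" by auto
  then show ?thesis using lborel_distr_plus[of "- z"] by simp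
qed

lemma nn_integral_lborel_diff_right:
  fixes z :: "'a::euclidean_space"
  assumes "f \<in> borel_measurable borel"
  shows "(\<integral>\<^sup>+x. f (x - z) \<partial>lborel) = (\<integral>\<^sup>+x. f x \<partial>lborel)"
  by (subst (2) lborel_distr_diff_right[of z, symmetric], subst nn_integral_distr) (use assms in auto)

lemma integral_lborel_diff_left:
  fixes t :: "'a::euclidean_space" and f :: "'a \<Rightarrow> real"
  assumes "f \<in> borel_measurable borel"
  shows "integrable lborel (\<lambda>x. f (t - x)) \<longleftrightarrow> integrable lborel f"
    and "(\<integral>x. f (t - x) \<partial>lborel) = (\<integral>x. f x \<partial>lborel)"
proof -
  show "integrable lborel (\<lambda>x. f (t - x)) \<longleftrightarrow> integrable lborel f"
    by (subst (2) lborel_distr_diff_left[of t, symmetric], subst integrable_distr_eq) (use assms in auto)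
  show "(\<integral>x. f (t - x) \<partial>lborel) = (\<integral>x. f x \<partial>lborel)"
    by (subst (2) lborel_distr_diff_left[of t, symmetric], subst integral_distr) (use assms in auto)
qed

lemma tendsto_nn_integral_square_diff:
  fixes f :: "nat \<Rightarrow> 'a \<Rightarrow> real"
  assumes [measurable]: "\<And>n. f n \<in> borel_measurable M" "g \<in> borel_measurable M" "w \<in> borel_measurable M"
    and lim: "AE x in M. (\<lambda>n. f n x) \<longlonglongrightarrow> g x"
    and bound: "\<And>n x. \<bar>g x - f n x\<bar> \<le> w x" and w: "(\<integral>\<^sup>+x. ennreal ((w x)\<^sup>2) \<partial>M) < \<infinity>"
  shows "(\<lambda>n. \<integral>\<^sup>+x. ennreal ((g x - f n x)\<^sup>2) \<partial>M) \<longlonglongrightarrow> 0"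
proof -
  have "(\<lambda>n. \<integral>\<^sup>+x. ennreal ((g x - f n x)\<^sup>2) \<partial>M) \<longlonglongrightarrow> (\<integral>\<^sup>+x. 0 \<partial>M)"
  proof (rule nn_integral_dominated_convergence[where w="\<lambda>x. ennreal ((w x)\<^sup>2)"])
    show "AE x in M. ennreal ((g x - f n x)\<^sup>2) \<le> ennreal ((w x)\<^sup>2)" for n
    proof (intro AE_I2 ennreal_leI)
      show "(g x - f n x)\<^sup>2 \<le> (w x)\<^sup>2" for x
        using power_mono[OF bound abs_ge_zero, of x n 2] by simp
    qed
    show "AE x in M. (\<lambda>n. ennreal ((g x - f n x)\<^sup>2)) \<longlonglongrightarrow> 0"
      using lim
    proof eventually_elim
      case (elim x)
      then have "(\<lambda>n. (g x - f n x)\<^sup>2) \<longlonglongrightarrow> (g x - g x)\<^sup>2" by (intro tendsto_intros)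
      from tendsto_ennrealI[OF this] show ?case by simp
    qed
  qed (use w in auto)
  then show ?thesis by simp
qed

text \<open>From (a + b)^2 <= 2 a^2 + 2 b^2. It replaces Minkowski's inequality, so that squared
  norms can be used throughout; the factors 2 explain the fractions of epsilon chosen below.\<close>

lemma nn_integral_square_diff_triangle:
  fixes f g h :: "'a \<Rightarrow> real"
  assumes [measurable]: "f \<in> borel_measurable M" "g \<in> borel_measurable M" "h \<in> borel_measurable M"
  shows "(\<integral>\<^sup>+x. ennreal ((f x - h x)\<^sup>2) \<partial>M)
    \<le> 2 * (\<integral>\<^sup>+x. ennreal ((f x - g x)\<^sup>2) \<partial>M) + 2 * (\<integral>\<^sup>+x. ennreal ((g x - h x)\<^sup>2) \<partial>M)"
proof -
  have "(\<integral>\<^sup>+x. ennreal ((f x - h x)\<^sup>2) \<partial>M) \<le> (\<integral>\<^sup>+x. 2 * ennreal ((f x - g x)\<^sup>2) + 2 * ennreal ((g x - h x)\<^sup>2) \<partial>M)"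
  proof (intro nn_integral_mono)
    fix x
    have "(f x - h x)\<^sup>2 \<le> 2 * (f x - g x)\<^sup>2 + 2 * (g x - h x)\<^sup>2"
      using sum_squares_bound[of "f x - g x" "g x - h x"] by (simp add: power2_eq_square algebra_simps)
    from ennreal_leI[OF this]
    show "ennreal ((f x - h x)\<^sup>2) \<le> 2 * ennreal ((f x - g x)\<^sup>2) + 2 * ennreal ((g x - h x)\<^sup>2)"
      by (simp add: ennreal_plus ennreal_mult' flip: ennreal_numeral)
  qed
  also have "\<dots> = 2 * (\<integral>\<^sup>+x. ennreal ((f x - g x)\<^sup>2) \<partial>M) + 2 * (\<integral>\<^sup>+x. ennreal ((g x - h x)\<^sup>2) \<partial>M)"
    by (subst nn_integral_add) (auto simp: nn_integral_cmult)
  finally show ?thesis .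
qed

text \<open>Truncate F to a bounded function, approximate that almost everywhere by continuous
  functions, and clip and cut these off so that dominated convergence applies on a ball.\<close>

lemma L2_approx_continuous:
  fixes F :: "'a::euclidean_space \<Rightarrow> real"
  assumes F [measurable]: "F \<in> borel_measurable borel" and L2: "(\<integral>\<^sup>+x. ennreal ((F x)\<^sup>2) \<partial>lborel) < \<infinity>"
    and R: "\<And>x. F x \<noteq> 0 \<Longrightarrow> norm x \<le> R" and \<epsilon>: "\<epsilon> > (0::real)"
  obtains G where "continuous_on UNIV G" "\<And>x. G x \<noteq> 0 \<Longrightarrow> norm x \<le> R + 1"
    "(\<integral>\<^sup>+x. ennreal ((F x - G x)\<^sup>2) \<partial>lborel) \<le> ennreal \<epsilon>"
proof -
  define T where "T n x = max (- real n) (min (real n) (F x))" for n x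
  have [measurable]: "T n \<in> borel_measurable borel" for n
    unfolding T_def by measurable
  have T_lim: "(\<lambda>n. T n x) \<longlonglongrightarrow> F x" for x
  proof (rule tendsto_eventually)
    show "\<forall>\<^sub>F n in sequentially. T n x = F x"
      using eventually_ge_at_top[of "nat \<lceil>\<bar>F x\<bar>\<rceil>"]
      by eventually_elim (auto simp: T_def nat_le_iff ceiling_le_iff)
  qed
  have "(\<lambda>n. \<integral>\<^sup>+x. ennreal ((F x - T n x)\<^sup>2) \<partial>lborel) \<longlonglongrightarrow> 0"
    by (rule tendsto_nn_integral_square_diff[where w="\<lambda>x. \<bar>F x\<bar>"])
      (use T_lim L2 in \<open>auto simp: T_def\<close>)
  then have "\<forall>\<^sub>F n in sequentially. (\<integral>\<^sup>+x. ennreal ((F x - T n x)\<^sup>2) \<partial>lborel) < ennreal (\<epsilon> / 4)"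
    using \<epsilon> by (intro order_tendstoD(2)) auto
  then obtain n where n: "(\<integral>\<^sup>+x. ennreal ((F x - T n x)\<^sup>2) \<partial>lborel) < ennreal (\<epsilon> / 4)"
    by (auto simp: eventually_sequentially)
  \<comment> \<open>\<open>measurable_on\<close> supplies continuous functions converging to
    \<open>T n\<close> off a negligible set, but without any bound on them.\<close>
  have "T n measurable_on UNIV"
    by (rule lebesgue_measurable_imp_measurable_on_real) (auto intro: measurable_completion)
  then obtain N g where N: "negligible N" and g: "\<And>k. continuous_on UNIV (g k)"
    and g_lim: "\<And>x. x \<notin> N \<Longrightarrow> (\<lambda>k. g k x) \<longlonglongrightarrow> T n x"
    by (auto simp: measurable_on_def)
  have AE_N: "AE x in lborel. x \<notin> N"
    using AE_not_in[OF N[unfolded negligible_iff_null_sets]] by (simp add: AE_completion_iff)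
  \<comment> \<open>The cutoff is 1 on the ball of radius R, outside which \<open>T n\<close>
    vanishes, and 0 beyond R + 1. Together with clipping to [-n, n] it gives the dominating function
    2 n on the larger ball and does not disturb the limit.\<close>
  define cut where "cut x = max 0 (min 1 (R + 1 - norm x))" for x :: 'a
  define G where "G k x = cut x * max (- real n) (min (real n) (g k x))" for k x
  have G_cont: "continuous_on UNIV (G k)" for k
    unfolding G_def cut_def by (intro continuous_intros g)
  then have Gm [measurable]: "G k \<in> borel_measurable lborel" for k
    using borel_measurable_continuous_onI[of "G k"] by simp
  have Tm: "T n \<in> borel_measurable lborel" by simp
  have wm: "(\<lambda>x. 2 * real n * indicator (cball 0 (R + 1)) x) \<in> borel_measurable (lborel :: 'a measure)"
    by (intro borel_measurable_times borel_measurable_const borel_measurable_indicator) simp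
  have G_supp: "norm x \<le> R + 1" if "G k x \<noteq> 0" for k x
    using that by (auto simp: G_def cut_def max_def split: if_splits)
  have cutT: "cut x * T n x = T n x" for x
    using R[of x] by (cases "F x = 0") (auto simp: cut_def T_def)
  have "(\<lambda>k. \<integral>\<^sup>+x. ennreal ((T n x - G k x)\<^sup>2) \<partial>lborel) \<longlonglongrightarrow> 0"
  proof (rule tendsto_nn_integral_square_diff[OF Gm Tm wm])
    show "AE x in lborel. (\<lambda>k. G k x) \<longlonglongrightarrow> T n x"
      using AE_N
    proof eventually_elim
      case (elim x)
      have "(\<lambda>k. G k x) \<longlonglongrightarrow> cut x * max (- real n) (min (real n) (T n x))"
        unfolding G_def by (intro tendsto_intros g_lim elim)
      then show ?case by (simp add: T_def cutT[unfolded T_def])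
    qed
    show "\<bar>T n x - G k x\<bar> \<le> 2 * real n * indicator (cball 0 (R + 1)) x" for k x
    proof (cases "norm x \<le> R + 1")
      case True
      have "\<bar>max (- real n) (min (real n) y)\<bar> \<le> real n" for y by auto
      moreover from this have "\<bar>G k x\<bar> \<le> 1 * real n"
        unfolding G_def abs_mult by (intro mult_mono) (auto simp: cut_def)
      ultimately have "\<bar>T n x\<bar> \<le> n" "\<bar>G k x\<bar> \<le> n" by (auto simp: T_def)
      with True show ?thesis by (auto simp: abs_le_iff)
    next
      case False
      then have "G k x = 0" "F x = 0" using G_supp[of k x] R[of x] by auto
      then show ?thesis by (simp add: T_def)
    qed
    have "(\<integral>\<^sup>+x. ennreal ((2 * real n * indicator (cball 0 (R + 1)) x)\<^sup>2) \<partial>(lborel :: 'a measure))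
      = (\<integral>\<^sup>+x. ennreal ((2 * real n)\<^sup>2) * indicator (cball 0 (R + 1)) x \<partial>(lborel :: 'a measure))"
      by (intro nn_integral_cong) (auto simp: indicator_def)
    also have "\<dots> = ennreal ((2 * real n)\<^sup>2) * emeasure lborel (cball (0::'a) (R + 1))"
      by (subst nn_integral_cmult_indicator) auto
    also have "\<dots> < \<infinity>"
      using emeasure_lborel_cball_finite[of "0::'a" "R+1"] by (auto simp: ennreal_mult_less_top top.not_eq_extremum)
    finally show "(\<integral>\<^sup>+x. ennreal ((2 * real n * indicator (cball 0 (R + 1)) x)\<^sup>2) \<partial>(lborel :: 'a measure)) < \<infinity>" .
  qed
  then have "\<forall>\<^sub>F k in sequentially. (\<integral>\<^sup>+x. ennreal ((T n x - G k x)\<^sup>2) \<partial>lborel) < ennreal (\<epsilon> / 4)"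
    using \<epsilon> by (intro order_tendstoD(2)) auto
  then obtain k where k: "(\<integral>\<^sup>+x. ennreal ((T n x - G k x)\<^sup>2) \<partial>lborel) < ennreal (\<epsilon> / 4)"
    by (auto simp: eventually_sequentially)
  have "(\<integral>\<^sup>+x. ennreal ((F x - G k x)\<^sup>2) \<partial>lborel) \<le> 2 * ennreal (\<epsilon> / 4) + 2 * ennreal (\<epsilon> / 4)"
    by (rule order_trans[OF nn_integral_square_diff_triangle[where g="T n"]])
      (auto intro!: add_mono mult_left_mono less_imp_le[OF n] less_imp_le[OF k])
  also have "\<dots> = ennreal \<epsilon>"
    using \<epsilon> by (simp flip: ennreal_numeral ennreal_mult' ennreal_plus)
  finally show ?thesis
    by (intro that[of "G k"] G_cont G_supp) auto
qed

text \<open>Compare F with a compactly supported continuous G: translation is an isometry of L2, so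
  F and G stay close after a shift, and G is uniformly continuous on a ball.\<close>

lemma L2_translation_continuous:
  fixes F :: "'a::euclidean_space \<Rightarrow> real"
  assumes F [measurable]: "F \<in> borel_measurable borel" and L2: "(\<integral>\<^sup>+x. ennreal ((F x)\<^sup>2) \<partial>lborel) < \<infinity>"
    and R: "\<And>x. F x \<noteq> 0 \<Longrightarrow> norm x \<le> R" and \<epsilon>: "\<epsilon> > (0::real)"
  obtains \<delta> where "\<delta> > 0"
    "\<And>z. norm z < \<delta> \<Longrightarrow> (\<integral>\<^sup>+x. ennreal ((F (x - z) - F x)\<^sup>2) \<partial>lborel) \<le> ennreal \<epsilon>"
proof -
  \<comment> \<open>Two applications of the triangle inequality turn the three errors epsilon / 16
    first into epsilon / 4 and then into 5 epsilon / 8.\<close>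
  obtain G where G: "continuous_on UNIV G" and G_supp: "\<And>x. G x \<noteq> 0 \<Longrightarrow> norm x \<le> R + 1"
    and FG: "(\<integral>\<^sup>+x. ennreal ((F x - G x)\<^sup>2) \<partial>lborel) \<le> ennreal (\<epsilon> / 16)"
    using L2_approx_continuous[OF F L2 R, of "\<epsilon>/16"] \<epsilon> by auto
  have Gm [measurable]: "G \<in> borel_measurable borel"
    using G by (rule borel_measurable_continuous_onI)
  \<comment> \<open>For |z| < 1 the difference of G and its translate vanishes outside the ball of
    radius R + 2. The constant eta makes eta^2 V at most epsilon / 16, with V + 1 guarding against V
    = 0; the radius R + 3 used next leaves room for x - z.\<close>
  define V where "V = measure lborel (cball (0::'a) (R + 2))"
  define \<eta> where "\<eta> = sqrt (\<epsilon> / (16 * (V + 1)))"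
  have V: "V \<ge> 0" by (simp add: V_def)
  have \<eta>: "\<eta> > 0" using \<epsilon> V by (simp add: \<eta>_def)
  have "\<eta>\<^sup>2 * V \<le> \<epsilon> / 16"
    using \<epsilon> V by (simp add: \<eta>_def field_simps)
  have "uniformly_continuous_on (cball 0 (R + 3)) G"
    by (intro compact_uniformly_continuous continuous_on_subset[OF G]) auto
  then obtain d where d: "d > 0" "\<And>x y. \<lbrakk>norm x \<le> R + 3; norm y \<le> R + 3; dist y x < d\<rbrakk> \<Longrightarrow> dist (G y) (G x) < \<eta>"
    using \<eta> unfolding uniformly_continuous_on_def by (metis mem_cball_0)
  show ?thesis
  proof (rule that[of "min d 1"])
    fix z :: 'a assume z: "norm z < min d 1"
    have bound: "ennreal ((G (x - z) - G x)\<^sup>2) \<le> ennreal (\<eta>\<^sup>2) * indicator (cball 0 (R + 2)) x" for x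
    proof (cases "norm x \<le> R + 2")
      case True
      then have "norm (x - z) \<le> R + 3" using z norm_triangle_ineq4[of x z] by simp
      with True z d(2)[of x "x - z"] have "\<bar>G (x - z) - G x\<bar> < \<eta>"
        by (simp add: dist_norm)
      then have "(G (x - z) - G x)\<^sup>2 \<le> \<eta>\<^sup>2"
        by (intro abs_le_square_iff[THEN iffD1]) simp
      with True show ?thesis by (simp add: ennreal_leI)
    next
      case False
      moreover have "norm (x - z) > R + 1" using False z norm_triangle_ineq2[of x z] by linarith
      ultimately show ?thesis using G_supp[of x] G_supp[of "x - z"] by force
    qed
    have "(\<integral>\<^sup>+x. ennreal ((G (x - z) - G x)\<^sup>2) \<partial>lborel) \<le> (\<integral>\<^sup>+x. ennreal (\<eta>\<^sup>2) * indicator (cball 0 (R + 2)) x \<partial>(lborel :: 'a measure))"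
      by (intro nn_integral_mono bound)
    also have "\<dots> = ennreal (\<eta>\<^sup>2) * emeasure lborel (cball (0::'a) (R + 2))"
      by (subst nn_integral_cmult_indicator) auto
    also have "\<dots> = ennreal (\<eta>\<^sup>2 * V)"
      using emeasure_lborel_cball_finite[of "0::'a" "R + 2"]
      by (simp add: V_def emeasure_eq_ennreal_measure ennreal_mult top.not_eq_extremum)
    finally have GG: "(\<integral>\<^sup>+x. ennreal ((G (x - z) - G x)\<^sup>2) \<partial>lborel) \<le> ennreal (\<epsilon> / 16)"
      using \<open>\<eta>\<^sup>2 * V \<le> \<epsilon> / 16\<close> by (meson ennreal_leI order_trans)
    have FG': "(\<integral>\<^sup>+x. ennreal ((F (x - z) - G (x - z))\<^sup>2) \<partial>lborel) \<le> ennreal (\<epsilon> / 16)"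
      using FG by (subst nn_integral_lborel_diff_right[of "\<lambda>x. ennreal ((F x - G x)\<^sup>2)"]) auto
    have GF: "(\<integral>\<^sup>+x. ennreal ((G x - F x)\<^sup>2) \<partial>lborel) \<le> ennreal (\<epsilon> / 16)"
      using FG by (subst power2_commute) simp
    have "(\<integral>\<^sup>+x. ennreal ((G (x - z) - F x)\<^sup>2) \<partial>lborel) \<le> 2 * ennreal (\<epsilon> / 16) + 2 * ennreal (\<epsilon> / 16)"
      by (rule order_trans[OF nn_integral_square_diff_triangle[where g=G]])
        (use GG GF in \<open>auto intro!: add_mono mult_left_mono\<close>)
    also have "\<dots> = ennreal (\<epsilon> / 4)"
      using \<epsilon> by (simp flip: ennreal_numeral ennreal_mult' ennreal_plus)
    finally have GF': "(\<integral>\<^sup>+x. ennreal ((G (x - z) - F x)\<^sup>2) \<partial>lborel) \<le> ennreal (\<epsilon> / 4)" .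
    have "(\<integral>\<^sup>+x. ennreal ((F (x - z) - F x)\<^sup>2) \<partial>lborel) \<le> 2 * ennreal (\<epsilon> / 16) + 2 * ennreal (\<epsilon> / 4)"
      by (rule order_trans[OF nn_integral_square_diff_triangle[where g="\<lambda>x. G (x - z)"]])
        (use FG' GF' in \<open>auto intro!: add_mono mult_left_mono\<close>)
    also have "\<dots> = ennreal (\<epsilon> * (5 / 8))"
      using \<epsilon> by (simp flip: ennreal_numeral ennreal_mult' ennreal_plus)
    also have "\<dots> \<le> ennreal \<epsilon>"
      using \<epsilon> by (intro ennreal_leI) simp
    finally show "(\<integral>\<^sup>+x. ennreal ((F (x - z) - F x)\<^sup>2) \<partial>lborel) \<le> ennreal \<epsilon>" .
  qed (use d in auto)
qed

section \<open>The mean square error of a convolution\<close>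

text \<open>Jensen's inequality for the square, obtained from the nonnegativity of the variance of u
  under the probability density K.\<close>

lemma square_integral_le_weighted:
  fixes K u :: "'a \<Rightarrow> real"
  assumes K: "has_bochner_integral M K 1" "\<And>x. 0 \<le> K x"
    and u: "integrable M (\<lambda>x. K x * u x)" "integrable M (\<lambda>x. K x * (u x)\<^sup>2)"
  shows "(\<integral>x. K x * u x \<partial>M)\<^sup>2 \<le> (\<integral>x. K x * (u x)\<^sup>2 \<partial>M)"
proof -
  define m where "m = (\<integral>x. K x * u x \<partial>M)"
  have "0 \<le> (\<integral>x. K x * (u x - m)\<^sup>2 \<partial>M)"
    using K(2) by (intro integral_nonneg_AE) auto
  also have "\<dots> = (\<integral>x. K x * (u x)\<^sup>2 - 2 * m * (K x * u x) + m\<^sup>2 * K x \<partial>M)"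
    by (simp add: power2_eq_square algebra_simps)
  also have "\<dots> = (\<integral>x. K x * (u x)\<^sup>2 \<partial>M) - 2 * m * m + m\<^sup>2 * 1"
    using K(1) u by (simp add: has_bochner_integral_iff m_def)
  finally show ?thesis by (simp add: m_def power2_eq_square)
qed

text \<open>\<open>convol F K - F\<close> is the K-average of the translation differences F(x - z) -
  F(x). Jensen's inequality moves the square inside the average, and Tonelli leaves, for each z, the
  squared L2 error of a single translation.\<close>

lemma nn_integral_square_convol_diff:
  assumes Fm [measurable]: "F \<in> borel_measurable borel"
    and F: "integrable lborel F" "integrable lborel (\<lambda>x. (F x)\<^sup>2)"
    and K: "test_fun S K" "has_bochner_integral lborel K 1" "\<And>x. 0 \<le> K x"
    and \<delta>: "\<And>z. K z \<noteq> 0 \<Longrightarrow> (\<integral>\<^sup>+x. ennreal ((F (x - z) - F x)\<^sup>2) \<partial>lborel) \<le> ennreal \<epsilon>"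
  shows "(\<integral>\<^sup>+x. ennreal ((convol F K x - F x)\<^sup>2) \<partial>lborel) \<le> ennreal \<epsilon>"
proof -
  obtain C where C: "C > 0" "\<And>z. \<bar>K z\<bar> \<le> C" using test_fun_bounded[OF K(1)] by blast
  have Km [measurable]: "K \<in> borel_measurable borel"
    using K(1) by (intro smooth2_measurable) (simp add: test_fun_def)
  have le: "ennreal ((convol F K p - F p)\<^sup>2) \<le> (\<integral>\<^sup>+z. ennreal (K z) * ennreal ((F (p - z) - F p)\<^sup>2) \<partial>lborel)" for p
  proof -
    have i: "integrable lborel K" using K(2) by (simp add: has_bochner_integral_iff)
    have "integrable lborel (\<lambda>z. F (p - z) * K z)" "integrable lborel (\<lambda>z. (F (p - z))\<^sup>2 * K z)"
      using F by (auto intro!: integrable_mult_bounded_real[where C=C] C(2)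
          simp: integral_lborel_diff_left(1)[of F] integral_lborel_diff_left(1)[of "\<lambda>x. (F x)\<^sup>2"])
    note i = i this
    have "convol F K p = (\<integral>z. F (p - z) * K z \<partial>lborel)"
      unfolding convol_def
      by (subst integral_lborel_diff_left(2)[of "\<lambda>z. F z * K (p - z)" p, symmetric]) auto
    also have "\<dots> - F p = (\<integral>z. F (p - z) * K z - F p * K z \<partial>lborel)"
      using i K(2) by (simp add: has_bochner_integral_iff)
    finally have eq: "convol F K p - F p = (\<integral>z. K z * (F (p - z) - F p) \<partial>lborel)"
      by (simp add: algebra_simps)
    have i1: "integrable lborel (\<lambda>z. K z * (F (p - z) - F p))"
      using Bochner_Integration.integrable_diff[OF i(2) integrable_mult_right[OF i(1), of "F p"]]
      by (simp add: algebra_simps)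
    have i2: "integrable lborel (\<lambda>z. K z * (F (p - z) - F p)\<^sup>2)"
      using Bochner_Integration.integrable_add[OF Bochner_Integration.integrable_diff[OF i(3) integrable_mult_right[OF i(2), of "2 * F p"]]
        integrable_mult_right[OF i(1), of "(F p)\<^sup>2"]]
      by (simp add: power2_eq_square algebra_simps)
    have "(convol F K p - F p)\<^sup>2 \<le> (\<integral>z. K z * (F (p - z) - F p)\<^sup>2 \<partial>lborel)"
      unfolding eq by (rule square_integral_le_weighted[OF K(2,3) i1 i2])
    then have "ennreal ((convol F K p - F p)\<^sup>2) \<le> ennreal (\<integral>z. K z * (F (p - z) - F p)\<^sup>2 \<partial>lborel)"
      by (rule ennreal_leI)
    also have "\<dots> = (\<integral>\<^sup>+z. ennreal (K z * (F (p - z) - F p)\<^sup>2) \<partial>lborel)"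
      using K(3) by (intro nn_integral_eq_integral[symmetric] i2) auto
    finally show ?thesis using K(3) by (simp add: ennreal_mult)
  qed
  have "(\<integral>\<^sup>+p. ennreal ((convol F K p - F p)\<^sup>2) \<partial>lborel)
     \<le> (\<integral>\<^sup>+p. \<integral>\<^sup>+z. ennreal (K z) * ennreal ((F (p - z) - F p)\<^sup>2) \<partial>lborel \<partial>lborel)"
    by (intro nn_integral_mono le)
  also have "\<dots> = (\<integral>\<^sup>+z. \<integral>\<^sup>+p. ennreal (K z) * ennreal ((F (p - z) - F p)\<^sup>2) \<partial>lborel \<partial>lborel)"
    by (rule lborel_pair.Fubini') measurable
  also have "\<dots> = (\<integral>\<^sup>+z. ennreal (K z) * (\<integral>\<^sup>+p. ennreal ((F (p - z) - F p)\<^sup>2) \<partial>lborel) \<partial>lborel)"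
    by (simp add: nn_integral_cmult)
  also have "\<dots> \<le> (\<integral>\<^sup>+z. ennreal (K z) * ennreal \<epsilon> \<partial>lborel)"
  proof (intro nn_integral_mono)
    show "ennreal (K z) * (\<integral>\<^sup>+p. ennreal ((F (p - z) - F p)\<^sup>2) \<partial>lborel) \<le> ennreal (K z) * ennreal \<epsilon>" for z
      \<comment> \<open>The translation bound is assumed only where K is nonzero; elsewhere both
        sides vanish.\<close>
      by (cases "K z = 0") (auto intro!: mult_left_mono \<delta>)
  qed
  also have "\<dots> = (\<integral>\<^sup>+z. ennreal (K z) \<partial>lborel) * ennreal \<epsilon>"
    by (rule nn_integral_multc) simp
  also have "(\<integral>\<^sup>+z. ennreal (K z) \<partial>lborel) = 1"
    using K(2,3) by (subst nn_integral_eq_integral) (auto simp: has_bochner_integral_iff)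
  finally show ?thesis by simp
qed

section \<open>Green's formula and the corner\<close>

lemma Top_mult:
  assumes "f differentiable (at p)" "g differentiable (at p)"
  shows "Top lam (\<lambda>p. f p * g p) p = Top lam f p * g p + f p * Top lam g p"
  using assms by (simp add: Top_def px_mult algebra_simps)

lemma Top_add:
  assumes "f differentiable (at p)" "g differentiable (at p)"
  shows "Top lam (\<lambda>p. f p + g p) p = Top lam f p + Top lam g p"
  using assms by (simp add: Top_def px_add algebra_simps)

lemma Top_eqI:
  assumes "(f has_derivative f') (at p)"
  shows "Top lam f p = f' (0, 1) + lam * f' (1, 0)"
  using px_eq[OF assms] py_eq[OF assms] by (simp add: Top_def)

lemma test_fun_smooth2: "test_fun S f \<Longrightarrow> smooth2 f"
  by (simp add: test_fun_def)

lemma smooth2_Top: "smooth2 f \<Longrightarrow> smooth2 (Top lam f)"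
  unfolding Top_def[abs_def] by (intro smooth2_add smooth2_mult smooth2_const smooth2_px smooth2_py)

lemma test_fun_add: "test_fun S f \<Longrightarrow> test_fun S g \<Longrightarrow> test_fun S (\<lambda>p. f p + g p)"
  by (rule test_funI[where C="tsupp f \<union> tsupp g"])
    (auto simp: test_fun_def smooth2_add not_in_tsupp compact_eq_bounded_closed)

lemma test_fun_mult: "test_fun S f \<Longrightarrow> smooth2 g \<Longrightarrow> test_fun S (\<lambda>p. f p * g p)"
  by (rule test_funI[where C="tsupp f"])
    (auto simp: test_fun_def smooth2_mult not_in_tsupp compact_eq_bounded_closed)

lemma test_fun_Top: "test_fun S f \<Longrightarrow> test_fun S (Top lam f)"
  unfolding Top_def[abs_def]
  using test_fun_add[OF test_fun_px(2) test_fun_mult[OF test_fun_px(1) smooth2_const]]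
  by (simp add: mult.commute)

lemma integrable_mult_test_fun:
  assumes "integrable lborel F" "test_fun S f"
  shows "integrable lborel (\<lambda>p. F p * f p)"
proof -
  obtain C where "\<And>p. \<bar>f p\<bar> \<le> C" using test_fun_bounded[OF assms(2)] by blast
  then show ?thesis
    using assms smooth2_measurable[OF test_fun_smooth2[OF assms(2)]]
    by (intro integrable_mult_bounded_real[where C=C]) auto
qed

text \<open>For zero extensions F and G this is the expression in the trace conditions. Its
  vanishing for test functions f reaching across Gamma says that T F = G holds weakly there, with no
  boundary contribution.\<close>

definition green :: "real \<Rightarrow> (real \<times> real \<Rightarrow> real) \<Rightarrow> (real \<times> real \<Rightarrow> real) \<Rightarrow> (real \<times> real \<Rightarrow> real) \<Rightarrow> real" where
  "green lam F G f = (\<integral>p. G p * f p + F p * Top lam f p \<partial>lborel)"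

lemma green_integrable:
  assumes "integrable lborel F" "integrable lborel G" "test_fun S f"
  shows "integrable lborel (\<lambda>p. G p * f p + F p * Top lam f p)"
  using assms by (intro Bochner_Integration.integrable_add integrable_mult_test_fun[where S=S] test_fun_Top) auto

lemma green_add:
  assumes "integrable lborel F" "integrable lborel G" "test_fun S f" "test_fun S g"
  shows "green lam F G (\<lambda>p. f p + g p) = green lam F G f + green lam F G g"
proof -
  have "green lam F G (\<lambda>p. f p + g p)
     = (\<integral>p. (G p * f p + F p * Top lam f p) + (G p * g p + F p * Top lam g p) \<partial>lborel)"
    unfolding green_def using assms
    by (intro Bochner_Integration.integral_cong)
      (auto simp: Top_add test_fun_smooth2 smooth2_differentiable algebra_simps)
  then show ?thesis
    unfolding green_def using assms green_integrable by (simp del: Bochner_Integration.integral_add add: Bochner_Integration.integral_add[OF green_integrable green_integrable])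
qed

lemma smooth2_step_fst: "smooth2 (\<lambda>p. step (c * fst p))"
  and smooth2_step_snd: "smooth2 (\<lambda>p. step (c * snd p))"
  using smooth2_step[of c 0 0] smooth2_step[of 0 c 0] by simp_all

text \<open>Each derivative grows like c but lives on the strip where the scaled coordinate lies
  between 1 and 2. The form \<open>1 + -1 * s\<close> fits the closure of \<open>smooth2\<close>
  under sums and products.\<close>

lemma Top_step:
  "Top lam (\<lambda>p. 1 + -1 * step (c * fst p)) p = - lam * c * kern (c * fst p)"
  "Top lam (\<lambda>p. 1 + -1 * step (c * snd p)) p = - c * kern (c * snd p)"
proof -
  have "((\<lambda>p. 1 + -1 * step (c * fst p)) has_derivative (\<lambda>h. - (c * fst h * kern (c * fst p)))) (at p)"
    by (auto intro!: derivative_eq_intros DERIV_compose_FDERIV[OF DERIV_step])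
  from Top_eqI[OF this, of lam] show "Top lam (\<lambda>p. 1 + -1 * step (c * fst p)) p = - lam * c * kern (c * fst p)" by simp
  have "((\<lambda>p. 1 + -1 * step (c * snd p)) has_derivative (\<lambda>h. - (c * snd h * kern (c * snd p)))) (at p)"
    by (auto intro!: derivative_eq_intros DERIV_compose_FDERIV[OF DERIV_step])
  from Top_eqI[OF this, of lam] show "Top lam (\<lambda>p. 1 + -1 * step (c * snd p)) p = - c * kern (c * snd p)" by simp
qed

text \<open>The two trace conditions do not see test functions reaching the corner \<open>(0, 0)\<close>. With
  \<open>a = step (n x)\<close>, \<open>b = step (n y)\<close> one writes \<open>\<phi> = \<phi> a + \<phi> b - \<phi> a b + r\<close>; the first three terms are
  admissible, and \<open>r\<close> lives on a square of area \<open>4 / n\<^sup>2\<close> where \<open>T r\<close> is at most \<open>D n\<close>. The bound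
  \<open>n \<bar>F\<bar> \<le> \<tau> n\<^sup>2 / 2 + F\<^sup>2 / (2 \<tau>)\<close> leaves a term vanishing with \<open>n \<rightarrow> \<infinity>\<close> and one of order \<open>\<tau>\<close>.\<close>

lemma green_corner_bound:
  assumes F: "integrable lborel F" "integrable lborel (\<lambda>p. (F p)\<^sup>2)" and G: "integrable lborel G"
    and supp: "\<And>p. \<not> (0 < fst p \<and> 0 < snd p) \<Longrightarrow> F p = 0 \<and> G p = 0"
    and W: "\<And>f. test_fun ({..<L1} \<times> {0<..<L2}) f \<Longrightarrow> green lam F G f = 0"
    and S: "\<And>f. test_fun ({0<..<L1} \<times> {..<L2}) f \<Longrightarrow> green lam F G f = 0"
    and \<phi>: "test_fun ({..<L1} \<times> {..<L2}) \<phi>" and lam: "lam > 0"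
  obtains M D where "D > 0" "M > 0" "\<And>n \<tau>. \<lbrakk>n \<ge> 1; \<tau> > 0\<rbrakk> \<Longrightarrow>
    \<bar>green lam F G \<phi>\<bar> \<le> (\<integral>p. (M * \<bar>G p\<bar> + D / (2 * \<tau>) * (F p)\<^sup>2) * indicator ({0<..2 / n} \<times> {0<..2 / n}) p \<partial>lborel)
       + 2 * D * \<tau>"
proof -
  obtain A where A: "A > 0" "\<And>p. \<bar>\<phi> p\<bar> \<le> A" using test_fun_bounded[OF \<phi>] by blast
  obtain B where B: "B > 0" "\<And>p. \<bar>Top lam \<phi> p\<bar> \<le> B" using test_fun_bounded[OF test_fun_Top[OF \<phi>]] by blast
  obtain C where C: "C > 0" "\<And>t. kern t \<le> C" using kern_bounded by blast
  \<comment> \<open>Sums the three terms of the product rule for T r: one with T phi, bounded by B,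
    and two with a differentiated cutoff, bounded by A lam C n and A C n. As n >= 1, the first is at
    most B n as well.\<close>
  define D where "D = B + A * (lam + 1) * C"
  have D: "D > 0" using A B C lam by (simp add: D_def add_pos_pos)
  show ?thesis
  proof (rule that[OF D A(1)])
    fix n \<tau> :: real assume n: "n \<ge> 1" and \<tau>: "\<tau> > 0"
    define Q where "Q = {0<..2 / n} \<times> {0<..2 / n}"
    have sm: "smooth2 \<phi>" "bounded (tsupp \<phi>)" "closed (tsupp \<phi>)" "tsupp \<phi> \<subseteq> {..<L1} \<times> {..<L2}"
      using \<phi> by (auto simp: test_fun_def compact_eq_bounded_closed)
    define a where "a p = step (n * fst p)" for p :: "real \<times> real"
    define b where "b p = step (n * snd p)" for p :: "real \<times> real"
    have sa: "smooth2 a" and sb: "smooth2 b"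
      unfolding a_def[abs_def] b_def[abs_def] by (rule smooth2_step_fst smooth2_step_snd)+
    have ca: "closed {p :: real \<times> real. 1 / n \<le> fst p}" and cb: "closed {p :: real \<times> real. 1 / n \<le> snd p}"
      by (intro closed_Collect_le continuous_intros)+
    have a0: "fst p < 1 / n \<Longrightarrow> a p = 0" and b0: "snd p < 1 / n \<Longrightarrow> b p = 0" for p
      using n by (auto simp: a_def b_def field_simps intro!: step_eq_0)
    \<comment> \<open>The factor \<open>a\<close> vanishes for x < 1 / n, which pushes the support
      off the side x = 0 and off the corner, so the condition on y = 0 applies; \<open>b\<close>
      works symmetrically.\<close>
    have ta: "test_fun ({0<..<L1} \<times> {..<L2}) (\<lambda>p. \<phi> p * a p)"
    proof (rule test_funI[where C="tsupp \<phi> \<inter> {p. 1 / n \<le> fst p}"])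
      have "0 < 1 / n" using n by simp
      then show "tsupp \<phi> \<inter> {p. 1 / n \<le> fst p} \<subseteq> {0<..<L1} \<times> {..<L2}"
        using sm(4) less_le_trans[OF \<open>0 < 1 / n\<close>] by (auto simp: subset_iff)
      show "\<phi> p * a p = 0" if "p \<notin> tsupp \<phi> \<inter> {p. 1 / n \<le> fst p}" for p
        using that not_in_tsupp[of p \<phi>] a0[of p] by auto
    qed (use sm ca sa in \<open>auto intro!: smooth2_mult bounded_Int closed_Int\<close>)
    have tb: "test_fun ({..<L1} \<times> {0<..<L2}) (\<lambda>p. \<phi> p * b p)"
    proof (rule test_funI[where C="tsupp \<phi> \<inter> {p. 1 / n \<le> snd p}"])
      have "0 < 1 / n" using n by simp
      then show "tsupp \<phi> \<inter> {p. 1 / n \<le> snd p} \<subseteq> {..<L1} \<times> {0<..<L2}"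
        using sm(4) less_le_trans[OF \<open>0 < 1 / n\<close>] by (auto simp: subset_iff)
      show "\<phi> p * b p = 0" if "p \<notin> tsupp \<phi> \<inter> {p. 1 / n \<le> snd p}" for p
        using that not_in_tsupp[of p \<phi>] b0[of p] by auto
    qed (use sm cb sb in \<open>auto intro!: smooth2_mult bounded_Int closed_Int\<close>)
    have tc: "test_fun ({..<L1} \<times> {0<..<L2}) (\<lambda>p. \<phi> p * b p * (-1 * a p))"
      by (intro test_fun_mult tb smooth2_mult smooth2_const sa)
    define a' where "a' p = 1 + -1 * a p" for p
    define b' where "b' p = 1 + -1 * b p" for p
    have sa': "smooth2 a'" and sb': "smooth2 b'"
      unfolding a'_def[abs_def] b'_def[abs_def] by (intro smooth2_add smooth2_mult smooth2_const sa sb)+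
    have ab: "0 \<le> a' p" "a' p \<le> 1" "0 \<le> b' p" "b' p \<le> 1" for p
      using step_bounds by (auto simp: a'_def b'_def a_def b_def)
    define r where "r p = \<phi> p * a' p * b' p" for p
    have tr: "test_fun ({..<L1} \<times> {..<L2}) r"
      unfolding r_def[abs_def] by (intro test_fun_mult \<phi> sa' sb')
    \<comment> \<open>The identity 1 = a + b - a b + (1 - a)(1 - b), multiplied by phi.\<close>
    have "\<phi> = (\<lambda>p. (\<phi> p * a p + \<phi> p * b p) + (\<phi> p * b p * (-1 * a p) + r p))"
      by (auto simp: fun_eq_iff r_def a'_def b'_def algebra_simps)
    then have "green lam F G \<phi> = green lam F G (\<lambda>p. (\<phi> p * a p + \<phi> p * b p) + (\<phi> p * b p * (-1 * a p) + r p))"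
      by (rule arg_cong)
    also have "\<dots> = (green lam F G (\<lambda>p. \<phi> p * a p) + green lam F G (\<lambda>p. \<phi> p * b p))
       + (green lam F G (\<lambda>p. \<phi> p * b p * (-1 * a p)) + green lam F G r)"
    proof -
      \<comment> \<open>The four pieces have different admissible supports; additivity needs a
        common class.\<close>
      note t = ta[THEN test_fun_UNIV] tb[THEN test_fun_UNIV] tc[THEN test_fun_UNIV] tr[THEN test_fun_UNIV]
      show ?thesis
        by (simp only: green_add[OF F(1) G test_fun_add[OF t(1,2)] test_fun_add[OF t(3,4)]]
          green_add[OF F(1) G t(1,2)] green_add[OF F(1) G t(3,4)])
    qed
    also have "\<dots> = green lam F G r"
      using S[OF ta] W[OF tb] W[OF tc] by simp
    finally have eq: "green lam F G \<phi> = green lam F G r" .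
    have Tr: "Top lam r p = (Top lam \<phi> p * a' p - \<phi> p * (lam * n * kern (n * fst p))) * b' p
        - \<phi> p * a' p * (n * kern (n * snd p))" for p
    proof -
      have "Top lam a' p = - lam * n * kern (n * fst p)" "Top lam b' p = - n * kern (n * snd p)"
        using Top_step[of lam n p] by (simp_all add: a'_def[abs_def] b'_def[abs_def] a_def b_def)
      then show ?thesis
        unfolding r_def[abs_def]
        by (simp add: Top_mult smooth2_differentiable smooth2_mult sm sa' sb')
    qed
    have Tr_bound: "\<bar>Top lam r p\<bar> \<le> D * n" for p
    proof -
      have k: "\<bar>kern t\<bar> \<le> C" for t using C(2)[of t] kern_nonneg[of t] by simp
      have "\<bar>Top lam r p\<bar> \<le> \<bar>Top lam \<phi> p * a' p * b' p\<bar> + \<bar>\<phi> p * (lam * n * kern (n * fst p)) * b' p\<bar>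
          + \<bar>\<phi> p * a' p * (n * kern (n * snd p))\<bar>"
        by (simp only: Tr left_diff_distrib)
      also have "\<dots> \<le> B * 1 * 1 + A * (lam * n * C) * 1 + A * 1 * (n * C)"
        unfolding abs_mult
        using A B C lam n ab[of p] k[of "n * fst p"] k[of "n * snd p"]
        by (intro add_mono mult_mono mult_nonneg_nonneg) auto
      also have "\<dots> \<le> B * n + A * (lam * n * C) * 1 + A * 1 * (n * C)"
        using B n by simp
      also have "\<dots> = D * n" by (simp add: D_def algebra_simps)
      finally show ?thesis .
    qed
    have r_bound: "\<bar>r p\<bar> \<le> A" for p
    proof -
      have "\<bar>r p\<bar> \<le> A * 1 * 1"
        unfolding r_def abs_mult using A ab[of p] by (intro mult_mono) auto
      then show ?thesis by simp
    qed
    have far: "r p = 0 \<and> Top lam r p = 0" if "fst p > 2 / n \<or> snd p > 2 / n" for p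
    proof -
      \<comment> \<open>Past 2 / n a cutoff is constantly 1, so both its complement and its
        derivative vanish there, and with them r and T r.\<close>
      have "a' p = 0 \<and> kern (n * fst p) = 0 \<or> b' p = 0 \<and> kern (n * snd p) = 0"
        using that n by (auto simp: a'_def b'_def a_def b_def field_simps step_eq_1 kern_eq_0)
      then show ?thesis by (auto simp: r_def Tr)
    qed
    define h where "h p = (A * \<bar>G p\<bar> + D / (2 * \<tau>) * (F p)\<^sup>2) * indicator Q p" for p
    have Qm: "Q \<in> sets lborel" "emeasure lborel Q = ennreal (4 / n\<^sup>2)"
    proof -
      have "Q \<in> sets (borel \<Otimes>\<^sub>M borel)" unfolding Q_def by (intro pair_measureI) auto
      then show "Q \<in> sets lborel" unfolding borel_prod by simp
      have "emeasure lborel Q = emeasure (lborel \<Otimes>\<^sub>M lborel) Q" by (simp add: lborel_prod)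
      also have "\<dots> = ennreal (2 / n) * ennreal (2 / n)"
        unfolding Q_def using n by (subst lborel.emeasure_pair_measure_Times) auto
      finally show "emeasure lborel Q = ennreal (4 / n\<^sup>2)"
        using n by (simp flip: ennreal_mult add: power2_eq_square)
    qed
    have hi: "integrable lborel h"
      unfolding h_def[abs_def] using Qm F G
      by (intro integrable_mult_bounded_real[where C=1]) (auto simp: indicator_def)
    have Qi: "integrable lborel (\<lambda>p. D * \<tau> * n\<^sup>2 / 2 * indicator Q p)"
      using Qm by (intro integrable_mult_right integrable_real_indicator) auto
    have pt: "\<bar>G p * r p + F p * Top lam r p\<bar> \<le> h p + D * \<tau> * n\<^sup>2 / 2 * indicator Q p" for p
    proof (cases "p \<in> Q")
      case True
      have "0 \<le> (n * \<tau> - \<bar>F p\<bar>)\<^sup>2" by simp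
      then have "\<bar>F p\<bar> * n \<le> \<tau> * n\<^sup>2 / 2 + (F p)\<^sup>2 / (2 * \<tau>)"
        using \<tau> by (simp add: power2_eq_square field_simps)
      from mult_left_mono[OF this, of D] D
      have *: "\<bar>F p\<bar> * (D * n) \<le> D * \<tau> * n\<^sup>2 / 2 + D / (2 * \<tau>) * (F p)\<^sup>2" by (simp add: algebra_simps)
      have "\<bar>G p * r p + F p * Top lam r p\<bar> \<le> \<bar>G p\<bar> * \<bar>r p\<bar> + \<bar>F p\<bar> * \<bar>Top lam r p\<bar>"
        by (metis abs_mult abs_triangle_ineq)
      also have "\<dots> \<le> \<bar>G p\<bar> * A + \<bar>F p\<bar> * (D * n)"
        by (intro add_mono mult_left_mono r_bound Tr_bound) auto
      finally show ?thesis using * True by (simp add: h_def algebra_simps)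
    next
      case False
      then have "F p = 0 \<and> G p = 0 \<or> r p = 0 \<and> Top lam r p = 0"
        using far[of p] supp[of p] by (cases p) (auto simp: Q_def not_le)
      then show ?thesis using False by (auto simp: h_def)
    qed
    have "\<bar>green lam F G r\<bar> \<le> (\<integral>p. h p + D * \<tau> * n\<^sup>2 / 2 * indicator Q p \<partial>lborel)"
      unfolding green_def
      by (rule order_trans[OF integral_abs_bound integral_mono[OF integrable_abs[OF green_integrable[OF F(1) G tr]] _ pt]])
        (intro Bochner_Integration.integrable_add hi Qi)
    also have "\<dots> = (\<integral>p. h p \<partial>lborel) + D * \<tau> * n\<^sup>2 / 2 * measure lborel Q"
      using hi Qi Qm by (subst Bochner_Integration.integral_add) auto
    \<comment> \<open>The area 4 / n^2 cancels the factor n^2 exactly, so this term does not depend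
      on n.\<close>
    also have "D * \<tau> * n\<^sup>2 / 2 * measure lborel Q = 2 * D * \<tau>"
      using Qm n by (simp add: measure_def)
    finally show "\<bar>green lam F G \<phi>\<bar> \<le> (\<integral>p. (A * \<bar>G p\<bar> + D / (2 * \<tau>) * (F p)\<^sup>2) * indicator ({0<..2 / n} \<times> {0<..2 / n}) p \<partial>lborel)
       + 2 * D * \<tau>"
      unfolding eq h_def Q_def .
  qed
qed

text \<open>The order of limits matters: n tends to infinity with tau fixed, since the coefficient D
  / (2 tau) is unbounded as tau decreases; afterwards tau is arbitrary.\<close>

lemma green_corner:
  assumes F: "integrable lborel F" "integrable lborel (\<lambda>p. (F p)\<^sup>2)" and G: "integrable lborel G"
    and supp: "\<And>p. \<not> (0 < fst p \<and> 0 < snd p) \<Longrightarrow> F p = 0 \<and> G p = 0"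
    and W: "\<And>f. test_fun ({..<L1} \<times> {0<..<L2}) f \<Longrightarrow> green lam F G f = 0"
    and S: "\<And>f. test_fun ({0<..<L1} \<times> {..<L2}) f \<Longrightarrow> green lam F G f = 0"
    and \<phi>: "test_fun ({..<L1} \<times> {..<L2}) \<phi>" and lam: "lam > 0"
  shows "green lam F G \<phi> = 0"
proof (rule green_corner_bound[OF assms])
  fix M D :: real assume MD: "D > 0" "M > 0" and bound: "\<And>n \<tau>. \<lbrakk>n \<ge> 1; \<tau> > 0\<rbrakk> \<Longrightarrow>
    \<bar>green lam F G \<phi>\<bar> \<le> (\<integral>p. (M * \<bar>G p\<bar> + D / (2 * \<tau>) * (F p)\<^sup>2) * indicator ({0<..2 / n} \<times> {0<..2 / n}) p \<partial>lborel)
       + 2 * D * \<tau>"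
  have le: "\<bar>green lam F G \<phi>\<bar> \<le> 0 + 2 * D * \<tau>" if \<tau>: "\<tau> > 0" for \<tau>
  proof (rule tendsto_lowerbound)
    let ?h = "\<lambda>p. M * \<bar>G p\<bar> + D / (2 * \<tau>) * (F p)\<^sup>2"
    let ?Q = "\<lambda>n::nat. {0<..2 / real n} \<times> {0<..2 / real n}"
    have Qm: "?Q n \<in> sets lborel" for n
    proof -
      have "?Q n \<in> sets (borel \<Otimes>\<^sub>M borel)" by (intro pair_measureI) auto
      then show ?thesis unfolding borel_prod by simp
    qed
    have hi: "integrable lborel ?h" using F G by simp
    have "(\<lambda>n. \<integral>p. ?h p * indicator (?Q n) p \<partial>lborel) \<longlonglongrightarrow> (\<integral>p. 0 \<partial>(lborel :: (real \<times> real) measure))"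
    proof (rule integral_dominated_convergence[where w="?h"])
      show "AE p in lborel. (\<lambda>n. ?h p * indicator (?Q n) p) \<longlonglongrightarrow> 0"
      proof (intro AE_I2 tendsto_eventually)
        fix p :: "real \<times> real"
        \<comment> \<open>The squares are open at 0, so every point eventually leaves them,
          including points on the axes, which never belong to them.\<close>
        have "(\<lambda>n. 2 / real n) \<longlonglongrightarrow> 0" by (rule lim_const_over_n)
        then have "\<forall>\<^sub>F n in sequentially. 2 / real n < fst p" if "0 < fst p"
          using that by (rule order_tendstoD(2))
        then have "\<forall>\<^sub>F n in sequentially. p \<notin> ?Q n"
          by (cases "0 < fst p") (auto elim!: eventually_mono simp: mem_Times_iff)
        then show "\<forall>\<^sub>F n in sequentially. ?h p * indicator (?Q n) p = 0"
          by eventually_elim simp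
      qed
      show "AE p in lborel. norm (?h p * indicator (?Q n) p) \<le> ?h p" for n
        using MD \<tau> by (intro AE_I2) (auto simp: indicator_def)
      show "(\<lambda>p. ?h p * indicator (?Q n) p) \<in> borel_measurable lborel" for n
        using hi Qm[of n] by (intro borel_measurable_times borel_measurable_indicator) auto
    qed (use hi in auto)
    then show "(\<lambda>n. (\<integral>p. ?h p * indicator (?Q n) p \<partial>lborel) + 2 * D * \<tau>) \<longlonglongrightarrow> 0 + 2 * D * \<tau>"
      by (intro tendsto_intros) simp
    show "\<forall>\<^sub>F n in sequentially. \<bar>green lam F G \<phi>\<bar> \<le> (\<integral>p. ?h p * indicator (?Q n) p \<partial>lborel) + 2 * D * \<tau>"
      using eventually_ge_at_top[of 1] by eventually_elim (rule bound[OF _ \<tau>], simp)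
  qed simp
  show ?thesis
  proof (rule ccontr)
    assume "green lam F G \<phi> \<noteq> 0"
    then show False
      \<comment> \<open>This tau makes the upper bound half of the absolute value, which is
        impossible for a nonzero number.\<close>
      using le[of "\<bar>green lam F G \<phi>\<bar> / (4 * D)"] MD by (simp add: field_simps)
  qed
qed

section \<open>Integration by parts on the rectangle\<close>

lemma Omega_sets: "Omega L1 L2 \<in> sets borel"
  unfolding Omega_def by (intro borel_open open_Times) auto

lemma Omega_subset_cl: "Omega L1 L2 \<subseteq> Omega_cl L1 L2"
  unfolding Omega_def Omega_cl_def by (intro Sigma_mono) auto

lemma compact_Omega_cl: "compact (Omega_cl L1 L2)"
  unfolding Omega_cl_def by (intro compact_Times compact_Icc)

lemma set_integrable_Omega_continuous:
  fixes f :: "real \<times> real \<Rightarrow> real"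
  assumes "continuous_on UNIV f"
  shows "set_integrable lborel (Omega L1 L2) f"
proof (rule set_integrable_subset[OF _ _ Omega_subset_cl])
  show "set_integrable lborel (Omega_cl L1 L2) f"
    unfolding set_integrable_def
    by (intro borel_integrable_compact compact_Omega_cl continuous_on_subset[OF assms]) simp
qed (simp add: Omega_sets)

lemma integral_Ioo_derivative:
  fixes f :: "real \<Rightarrow> real"
  assumes "a \<le> b" "\<And>x. (f has_real_derivative f' x) (at x)" "continuous_on UNIV f'"
  shows "(\<integral>x. indicator {a<..<b} x * f' x \<partial>lborel) = f b - f a"
proof -
  have "(\<integral>x. indicator {a<..<b} x * f' x \<partial>lborel) = (\<integral>x. f' x * indicator {a..b} x \<partial>lborel)"
  proof (rule integral_cong_AE)
    have [measurable]: "f' \<in> borel_measurable borel"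
      using assms(3) by (rule borel_measurable_continuous_onI)
    show "(\<lambda>x. indicator {a<..<b} x * f' x) \<in> borel_measurable lborel" by simp
    show "(\<lambda>x. f' x * indicator {a..b} x) \<in> borel_measurable lborel" by simp
    show "AE x in lborel. indicator {a<..<b} x * f' x = f' x * indicator {a..b} x"
      using AE_lborel_singleton[of a] AE_lborel_singleton[of b]
      by eventually_elim (auto simp: indicator_def)
  qed
  also have "\<dots> = f b - f a"
    by (rule integral_FTC_Icc_real)
      (use assms in \<open>auto simp: continuous_on_eq_continuous_at\<close>)
  finally show ?thesis .
qed

lemma integral_px_Omega:
  assumes f: "smooth2 f" and L: "L1 \<ge> 0"
    and bd: "\<And>y. y \<in> {0<..<L2} \<Longrightarrow> f (0, y) = f (L1, y)"
  shows "(LINT p:Omega L1 L2|lborel. px f p) = 0"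
proof -
  have i: "integrable (lborel \<Otimes>\<^sub>M lborel) (\<lambda>(x, y). indicator {0<..<L1} x * indicator {0<..<L2} y * px f (x, y))"
    using set_integrable_Omega_continuous[OF smooth2_continuous[OF smooth2_px[OF f]], of L1 L2]
    by (simp add: set_integrable_def lborel_prod Omega_def indicator_times case_prod_unfold)
  have "(LINT p:Omega L1 L2|lborel. px f p)
      = (\<integral>y. \<integral>x. indicator {0<..<L1} x * indicator {0<..<L2} y * px f (x, y) \<partial>lborel \<partial>lborel)"
    by (subst lborel_pair.integral_snd[OF i])
      (simp add: set_lebesgue_integral_def lborel_prod Omega_def indicator_times case_prod_unfold)
  also have "\<dots> = (\<integral>y. 0 \<partial>(lborel :: real measure))"
  proof (intro Bochner_Integration.integral_cong refl)
    fix y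
    have "(\<integral>x. indicator {0<..<L1} x * px f (x, y) \<partial>lborel) = f (L1, y) - f (0, y)"
    proof (rule integral_Ioo_derivative[OF L])
      show "((\<lambda>x. f (x, y)) has_real_derivative px f (x, y)) (at x)" for x
        using has_derivative_imp_px[OF has_derivative_px_py[OF smooth2_differentiable[OF f, of "(x, y)"]]] by simp
      show "continuous_on UNIV (\<lambda>x. px f (x, y))"
        by (rule continuous_on_compose2[OF smooth2_continuous[OF smooth2_px[OF f]]]) (auto intro!: continuous_intros)
    qed
    then have "indicator {0<..<L2} y * (\<integral>x. indicator {0<..<L1} x * px f (x, y) \<partial>lborel) = 0"
      using bd[of y] by (auto simp: indicator_def)
    then show "(\<integral>x. indicator {0<..<L1} x * indicator {0<..<L2} y * px f (x, y) \<partial>lborel) = 0"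
      by (simp flip: integral_mult_right_zero add: ac_simps)
  qed
  finally show ?thesis by simp
qed

lemma integral_py_Omega:
  assumes f: "smooth2 f" and L: "L2 \<ge> 0"
    and bd: "\<And>x. x \<in> {0<..<L1} \<Longrightarrow> f (x, 0) = f (x, L2)"
  shows "(LINT p:Omega L1 L2|lborel. py f p) = 0"
proof -
  have i: "integrable (lborel \<Otimes>\<^sub>M lborel) (\<lambda>(x, y). indicator {0<..<L1} x * indicator {0<..<L2} y * py f (x, y))"
    using set_integrable_Omega_continuous[OF smooth2_continuous[OF smooth2_py[OF f]], of L1 L2]
    by (simp add: set_integrable_def lborel_prod Omega_def indicator_times case_prod_unfold)
  have "(LINT p:Omega L1 L2|lborel. py f p)
      = (\<integral>x. \<integral>y. indicator {0<..<L1} x * indicator {0<..<L2} y * py f (x, y) \<partial>lborel \<partial>lborel)"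
    by (subst lborel_pair.integral_fst[OF i])
      (simp add: set_lebesgue_integral_def lborel_prod Omega_def indicator_times case_prod_unfold)
  also have "\<dots> = (\<integral>x. 0 \<partial>(lborel :: real measure))"
  proof (intro Bochner_Integration.integral_cong refl)
    fix x
    have "(\<integral>y. indicator {0<..<L2} y * py f (x, y) \<partial>lborel) = f (x, L2) - f (x, 0)"
    proof (rule integral_Ioo_derivative[OF L])
      show "((\<lambda>y. f (x, y)) has_real_derivative py f (x, y)) (at y)" for y
        using has_derivative_imp_py[OF has_derivative_px_py[OF smooth2_differentiable[OF f, of "(x, y)"]]] by simp
      show "continuous_on UNIV (\<lambda>y. py f (x, y))"
        by (rule continuous_on_compose2[OF smooth2_continuous[OF smooth2_py[OF f]]]) (auto intro!: continuous_intros)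
    qed
    then have "indicator {0<..<L1} x * (\<integral>y. indicator {0<..<L2} y * py f (x, y) \<partial>lborel) = 0"
      using bd[of x] by (auto simp: indicator_def)
    then show "(\<integral>y. indicator {0<..<L1} x * indicator {0<..<L2} y * py f (x, y) \<partial>lborel) = 0"
      by (simp flip: integral_mult_right_zero add: ac_simps)
  qed
  finally show ?thesis by simp
qed

text \<open>The integrand is T applied to psi phi. This product vanishes on all four sides: psi
  takes care of Gamma and the support of phi of x = L1 and y = L2, so integrating along lines leaves
  nothing.\<close>

lemma green_smooth:
  assumes L: "L1 > 0" "L2 > 0"
    and \<psi>: "smooth2 \<psi>" "\<And>p. p \<in> Gamma L1 L2 \<Longrightarrow> \<psi> p = 0"
    and \<phi>: "test_fun ({..<L1} \<times> {..<L2}) \<phi>"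
  shows "(LINT p:Omega L1 L2|lborel. Top lam \<psi> p * \<phi> p + \<psi> p * Top lam \<phi> p) = 0"
proof -
  define f where "f p = \<psi> p * \<phi> p" for p
  have f: "smooth2 f"
    unfolding f_def[abs_def] using \<psi>(1) \<phi> by (intro smooth2_mult) (auto simp: test_fun_def)
  have z: "\<phi> (L1, y) = 0" "\<phi> (x, L2) = 0" for x y
    using \<phi> by (auto simp: test_fun_def intro!: not_in_tsupp)
  have "(LINT p:Omega L1 L2|lborel. Top lam \<psi> p * \<phi> p + \<psi> p * Top lam \<phi> p)
      = (LINT p:Omega L1 L2|lborel. py f p + lam * px f p)"
    using Top_mult[of \<psi> _ \<phi> lam] \<psi>(1) \<phi>
    by (simp add: f_def[abs_def] Top_def[of lam "\<lambda>p. \<psi> p * \<phi> p"] smooth2_differentiable test_fun_def)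
  also have "\<dots> = (LINT p:Omega L1 L2|lborel. py f p) + lam * (LINT p:Omega L1 L2|lborel. px f p)"
    by (subst set_integral_add)
      (auto intro!: set_integrable_Omega_continuous smooth2_continuous smooth2_mult smooth2_const smooth2_px smooth2_py f)
  also have "\<dots> = 0"
    using L z \<psi>(2) by (subst integral_px_Omega integral_py_Omega; auto simp: f Gamma_def f_def)+
  finally show ?thesis .
qed

lemma L2_on_continuous:
  assumes "continuous_on UNIV f"
  shows "L2_on (Omega L1 L2) f"
  unfolding L2_on_def set_borel_measurable_def
  using borel_measurable_continuous_onI[OF assms] Omega_sets[of L1 L2]
  by (auto intro!: set_integrable_Omega_continuous continuous_intros assms)

lemma test_fun_mono: "test_fun S f \<Longrightarrow> S \<subseteq> S' \<Longrightarrow> test_fun S' f"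
  by (auto simp: test_fun_def)

text \<open>The weak equation and both trace conditions use test functions supported in x < L1, y <
  L2, so all three are instances of \<open>green_smooth\<close>.\<close>

lemma inX_smooth:
  assumes L: "L1 > 0" "L2 > 0"
    and \<psi>: "smooth2 \<psi>" "\<And>p. p \<in> Gamma L1 L2 \<Longrightarrow> \<psi> p = 0"
  shows "inX lam L1 L2 \<psi> (Top lam \<psi>)"
proof -
  have "(LINT p:Omega L1 L2|lborel. \<psi> p * Top lam \<phi> p) = - (LINT p:Omega L1 L2|lborel. Top lam \<psi> p * \<phi> p)"
    if "test_fun (Omega L1 L2) \<phi>" for \<phi>
  proof -
    have \<phi>: "test_fun ({..<L1} \<times> {..<L2}) \<phi>"
      using that by (rule test_fun_mono) (auto simp: Omega_def)
    have "(LINT p:Omega L1 L2|lborel. Top lam \<psi> p * \<phi> p + \<psi> p * Top lam \<phi> p) = 0"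
      by (rule green_smooth[OF L \<psi> \<phi>])
    then show ?thesis
      by (subst (asm) set_integral_add)
        (auto intro!: set_integrable_Omega_continuous smooth2_continuous smooth2_mult smooth2_Top \<psi>(1)
          test_fun_smooth2[OF that])
  qed
  then show ?thesis
    unfolding inX_def weakT_def trace_W_zero_def trace_S_zero_def
    by (auto intro!: L2_on_continuous smooth2_continuous smooth2_Top \<psi>(1) green_smooth[OF L \<psi>]
        elim!: test_fun_mono)
qed

text \<open>Omega has finite measure, so square integrability gives the integrability on which the
  convolution lemmas rest; pointwise this is |f| <= 1 + f^2.\<close>

lemma L2_on_zero_extension:
  assumes "L2_on (Omega L1 L2) f"
  defines "F \<equiv> \<lambda>p. indicator (Omega L1 L2) p * f p"
  shows "F \<in> borel_measurable borel" "integrable lborel (\<lambda>p. (F p)\<^sup>2)" "integrable lborel F"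
    "(\<integral>\<^sup>+p. ennreal ((F p)\<^sup>2) \<partial>lborel) < \<infinity>"
proof -
  show m: "F \<in> borel_measurable borel"
    using assms by (simp add: L2_on_def set_borel_measurable_def)
  have "(F p)\<^sup>2 = indicator (Omega L1 L2) p * (f p)\<^sup>2" for p
    by (simp add: F_def indicator_def)
  then show sq: "integrable lborel (\<lambda>p. (F p)\<^sup>2)"
    using assms by (simp add: L2_on_def set_integrable_def)
  then show "(\<integral>\<^sup>+p. ennreal ((F p)\<^sup>2) \<partial>lborel) < \<infinity>"
    by (subst nn_integral_eq_integral) auto
  have 1: "integrable lborel (\<lambda>p. indicator (Omega L1 L2) p :: real)"
    using set_integrable_Omega_continuous[of "\<lambda>_. 1" L1 L2] by (simp add: set_integrable_def)
  show "integrable lborel F"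
  proof (rule Bochner_Integration.integrable_bound[OF Bochner_Integration.integrable_add[OF 1 sq]])
    show "AE p in lborel. norm (F p) \<le> norm (indicator (Omega L1 L2) p + (F p)\<^sup>2)"
    proof (intro AE_I2)
      fix p
      have "0 \<le> (\<bar>f p\<bar> - 1)\<^sup>2" by simp
      then have "2 * \<bar>f p\<bar> \<le> 1 + (f p)\<^sup>2" by (simp add: power2_diff)
      then have "\<bar>f p\<bar> \<le> 1 + (f p)\<^sup>2" by simp
      then show "norm (F p) \<le> norm (indicator (Omega L1 L2) p + (F p)\<^sup>2)"
        by (simp add: F_def indicator_def)
    qed
  qed (use m in simp)
qed

section \<open>Density\<close>

lemma green_eq_set_integral:
  "green lam (\<lambda>p. indicator (Omega L1 L2) p * \<theta> p) (\<lambda>p. indicator (Omega L1 L2) p * g p) f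
   = (LINT p:Omega L1 L2|lborel. g p * f p + \<theta> p * Top lam f p)"
  unfolding green_def set_lebesgue_integral_def by (simp add: algebra_simps)

lemma test_fun_kern2:
  assumes "d > 0"
  shows "test_fun UNIV (kern2 d)"
proof (rule test_funI[where C="cbox (d, d) (2 * d, 2 * d)"])
  show "smooth2 (kern2 d)" using smooth2_kern2_affine[of d 0 1 0 1] by simp
  show "kern2 d p = 0" if "p \<notin> cbox (d, d) (2 * d, 2 * d)" for p
    using that kern2_eq_0[OF assms, of p] by (cases p) (auto simp: cbox_Pair_eq)
qed auto

text \<open>The support lies in the square p - [d, 2 d]^2, strictly below p in both coordinates. It
  may extend past x = 0 or y = 0 and may cover the corner, but it never meets x = L1 or y =
  L2.\<close>

lemma test_fun_kern2_reflect:
  assumes "d > 0" "p \<in> Omega L1 L2"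
  shows "test_fun ({..<L1} \<times> {..<L2}) (\<lambda>q. kern2 d (p - q))"
proof (rule test_funI[where C="cbox (p - (2 * d, 2 * d)) (p - (d, d))"])
  show "smooth2 (\<lambda>q. kern2 d (p - q))"
    using smooth2_kern2_affine[of d "fst p" "-1" "snd p" "-1"] by (cases p) (simp add: minus_prod_def)
  show "kern2 d (p - q) = 0" if "q \<notin> cbox (p - (2 * d, 2 * d)) (p - (d, d))" for q
    using that kern2_eq_0[OF assms(1), of "p - q"] by (cases p; cases q) (auto simp: cbox_Pair_eq)
  show "cbox (p - (2 * d, 2 * d)) (p - (d, d)) \<subseteq> {..<L1} \<times> {..<L2}"
    using assms by (cases p) (auto simp: cbox_Pair_eq Omega_def)
qed auto

text \<open>The sign turns the sum in \<open>green\<close> into the difference of two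
  convolutions.\<close>

lemma Top_reflect:
  assumes "smooth2 K"
  shows "Top lam (\<lambda>q. K (p - q)) q = - Top lam K (p - q)"
proof -
  have K: "(K has_derivative (\<lambda>h. px K (p - q) * fst h + py K (p - q) * snd h)) (at (p - q))"
    by (intro has_derivative_px_py smooth2_differentiable assms)
  have "((\<lambda>q. K (p - q)) has_derivative (\<lambda>h. px K (p - q) * fst (- h) + py K (p - q) * snd (- h))) (at q)"
    by (rule has_derivative_compose[of "\<lambda>q. p - q" uminus q UNIV K, OF _ K])
      (auto intro!: derivative_eq_intros)
  from Top_eqI[OF this, of lam] show ?thesis by (simp add: Top_def)
qed

text \<open>In the convolution T falls on the kernel; testing the weak equation with the reflected
  kernel then exchanges F for G. Membership of p in Omega is what makes that kernel an admissible
  test function.\<close>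

lemma Top_convol_kern2:
  assumes lam: "lam > 0" and X: "inX lam L1 L2 \<theta> g" and d: "d > 0" and p: "p \<in> Omega L1 L2"
  defines "F \<equiv> \<lambda>p. indicator (Omega L1 L2) p * \<theta> p" and "G \<equiv> \<lambda>p. indicator (Omega L1 L2) p * g p"
  shows "Top lam (convol F (kern2 d)) p = convol G (kern2 d) p"
proof -
  have L2: "L2_on (Omega L1 L2) \<theta>" "L2_on (Omega L1 L2) g" using X by (auto simp: inX_def)
  have F: "integrable lborel F" "integrable lborel (\<lambda>p. (F p)\<^sup>2)" and G: "integrable lborel G"
    using L2_on_zero_extension[OF L2(1)] L2_on_zero_extension[OF L2(2)] by (simp_all add: F_def G_def)
  have K: "test_fun UNIV (kern2 d)" by (rule test_fun_kern2[OF d])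
  have "green lam F G (\<lambda>q. kern2 d (p - q)) = 0"
  proof (rule green_corner[OF F G _ _ _ test_fun_kern2_reflect[OF d p] lam])
    show "\<not> (0 < fst p \<and> 0 < snd p) \<Longrightarrow> F p = 0 \<and> G p = 0" for p
      by (cases p) (auto simp: F_def G_def Omega_def)
    show "test_fun ({..<L1} \<times> {0<..<L2}) f \<Longrightarrow> green lam F G f = 0" for f
      using X by (simp add: inX_def trace_W_zero_def F_def G_def green_eq_set_integral)
    show "test_fun ({0<..<L1} \<times> {..<L2}) f \<Longrightarrow> green lam F G f = 0" for f
      using X by (simp add: inX_def trace_S_zero_def F_def G_def green_eq_set_integral)
  qed
  then have "(\<integral>q. G q * kern2 d (p - q) - F q * Top lam (kern2 d) (p - q) \<partial>lborel) = 0"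
    by (simp add: green_def Top_reflect test_fun_smooth2[OF K])
  then have "convol G (kern2 d) p - convol F (Top lam (kern2 d)) p = 0"
    unfolding convol_def
    using integrable_convol[OF G K] integrable_convol[OF F(1) test_fun_Top[OF K]]
    by simp
  then show ?thesis by (simp add: Top_convol[OF F(1) K])
qed

lemma convol_kern2_approx:
  assumes f: "L2_on (Omega L1 L2) f" and \<epsilon>: "\<epsilon> > (0 :: real)"
  obtains d0 where "d0 > 0" "\<And>d. \<lbrakk>0 < d; d < d0\<rbrakk> \<Longrightarrow>
    (LINT p:Omega L1 L2|lborel. (f p - convol (\<lambda>p. indicator (Omega L1 L2) p * f p) (kern2 d) p)\<^sup>2) \<le> \<epsilon>"
proof -
  define F where "F p = indicator (Omega L1 L2) p * f p" for p
  note F = L2_on_zero_extension[OF f, folded F_def]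
  have supp: "norm p \<le> \<bar>L1\<bar> + \<bar>L2\<bar>" if "F p \<noteq> 0" for p
  proof -
    have "norm p \<le> norm (fst p) + norm (snd p)" using norm_Pair_le[of "fst p" "snd p"] by simp
    with that show ?thesis by (cases p) (auto simp: F_def Omega_def indicator_def split: if_splits)
  qed
  obtain \<delta> where \<delta>: "\<delta> > 0"
    "\<And>z. norm z < \<delta> \<Longrightarrow> (\<integral>\<^sup>+x. ennreal ((F (x - z) - F x)\<^sup>2) \<partial>lborel) \<le> ennreal \<epsilon>"
    using L2_translation_continuous[OF F(1) F(4) supp \<epsilon>] by blast
  show ?thesis
  \<comment> \<open>Both coordinates of a point of the support lie below 2 d, so its norm is below 4
    d.\<close>
  proof (rule that[of "\<delta> / 4"])
    fix d :: real assume d: "0 < d" "d < \<delta> / 4"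
    have K: "test_fun UNIV (kern2 d)" by (rule test_fun_kern2[OF d(1)])
    have m: "convol F (kern2 d) \<in> borel_measurable borel" 
      by (intro smooth2_measurable smooth2_convol[OF F(3) K])
    have le: "(\<integral>\<^sup>+p. ennreal ((convol F (kern2 d) p - F p)\<^sup>2) \<partial>lborel) \<le> ennreal \<epsilon>"
    proof (rule nn_integral_square_convol_diff[OF F(1) F(3) F(2) K has_bochner_integral_kern2[OF d(1)] kern2_nonneg])
      fix z assume "kern2 d z \<noteq> 0"
      then have "d < fst z" "fst z < 2 * d" "d < snd z" "snd z < 2 * d"
        using kern2_eq_0[OF d(1), of z] by force+
      then have "norm z < \<delta>"
        using norm_Pair_le[of "fst z" "snd z"] d by simp
      then show "(\<integral>\<^sup>+x. ennreal ((F (x - z) - F x)\<^sup>2) \<partial>lborel) \<le> ennreal \<epsilon>" by (rule \<delta>(2))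
    qed
    have "(LINT p:Omega L1 L2|lborel. (f p - convol F (kern2 d) p)\<^sup>2)
       = (\<integral>p. indicator (Omega L1 L2) p * (convol F (kern2 d) p - F p)\<^sup>2 \<partial>lborel)"
      unfolding set_lebesgue_integral_def
      by (intro Bochner_Integration.integral_cong) (auto simp: F_def indicator_def power2_commute)
    also have "\<dots> = enn2real (\<integral>\<^sup>+p. ennreal (indicator (Omega L1 L2) p * (convol F (kern2 d) p - F p)\<^sup>2) \<partial>lborel)"
      using m F(1) Omega_sets[of L1 L2] by (intro integral_eq_nn_integral) auto
    also have "\<dots> \<le> enn2real (ennreal \<epsilon>)"
    proof (rule enn2real_mono)
      show "(\<integral>\<^sup>+p. ennreal (indicator (Omega L1 L2) p * (convol F (kern2 d) p - F p)\<^sup>2) \<partial>lborel) \<le> ennreal \<epsilon>"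
        by (rule order_trans[OF nn_integral_mono le]) (auto simp: indicator_def)
    qed simp
    finally show "(LINT p:Omega L1 L2|lborel. (f p - convol (\<lambda>p. indicator (Omega L1 L2) p * f p) (kern2 d) p)\<^sup>2) \<le> \<epsilon>"
      using \<epsilon> by (simp add: F_def[abs_def])
  qed (use \<delta> in simp)
qed

theorem theorem2p1:
  fixes L1 L2 lam :: real
  assumes "L1 > 0" and "L2 > 0" and "lam > 0"
  shows "\<forall>\<theta> g. inX lam L1 L2 \<theta> g \<longrightarrow>
           (\<forall>\<epsilon>>0. \<exists>\<psi>. inV L1 L2 \<psi> \<and> inX lam L1 L2 \<psi> (Top lam \<psi>)
                        \<and> Xdist L1 L2 \<theta> g \<psi> (Top lam \<psi>) < \<epsilon>)"
proof (intro allI impI)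
  fix \<theta> g :: "real \<times> real \<Rightarrow> real" and \<epsilon> :: real
  assume X: "inX lam L1 L2 \<theta> g" and \<epsilon>: "\<epsilon> > 0"
  define F where "F p = indicator (Omega L1 L2) p * \<theta> p" for p
  define G where "G p = indicator (Omega L1 L2) p * g p" for p
  have L2: "L2_on (Omega L1 L2) \<theta>" "L2_on (Omega L1 L2) g" using X by (auto simp: inX_def)
  \<comment> \<open>Thirds, because the two squared errors are bounded only weakly and their sum
    must be strictly below \<open>\<epsilon>\<^sup>2\<close>.\<close>
  have \<epsilon>3: "\<epsilon>\<^sup>2 / 3 > 0" using \<epsilon> by simp
  obtain d1 where d1: "d1 > 0" "\<And>d. \<lbrakk>0 < d; d < d1\<rbrakk> \<Longrightarrow>
      (LINT p:Omega L1 L2|lborel. (\<theta> p - convol F (kern2 d) p)\<^sup>2) \<le> \<epsilon>\<^sup>2 / 3"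
    using convol_kern2_approx[OF L2(1) \<epsilon>3] unfolding F_def[abs_def] by blast
  obtain d2 where d2: "d2 > 0" "\<And>d. \<lbrakk>0 < d; d < d2\<rbrakk> \<Longrightarrow>
      (LINT p:Omega L1 L2|lborel. (g p - convol G (kern2 d) p)\<^sup>2) \<le> \<epsilon>\<^sup>2 / 3"
    using convol_kern2_approx[OF L2(2) \<epsilon>3] unfolding G_def[abs_def] by blast
  define d where "d = min d1 d2 / 2"
  have d: "0 < d" "d < d1" "d < d2" using d1(1) d2(1) by (auto simp: d_def)
  define \<psi> where "\<psi> = convol F (kern2 d)"
  have smooth: "smooth2 \<psi>"
    unfolding \<psi>_def F_def[abs_def]
    by (rule smooth2_convol[OF L2_on_zero_extension(3)[OF L2(1)] test_fun_kern2[OF d(1)]])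
  \<comment> \<open>The factor F q requires q to have positive coordinates, and the kernel requires
    p - q to exceed d in each coordinate; together they force both coordinates of p above d.\<close>
  have zero: "\<psi> p = 0" if "fst p < d \<or> snd p < d" for p
  proof -
    have *: "F q * kern2 d (p - q) = 0" for q
    proof (cases "q \<in> Omega L1 L2")
      case True
      then have "0 < fst q" "0 < snd q" by (auto simp: Omega_def)
      with that show ?thesis using kern2_eq_0[OF d(1), of "p - q"] by force
    qed (simp add: F_def)
    show ?thesis unfolding \<psi>_def convol_def * by simp
  qed
  have V: "inV L1 L2 \<psi>"
    unfolding inV_def
  proof (intro conjI exI[of _ "{p. fst p < d} \<union> {p. snd p < d}"])
    show "open ({p. fst p < d} \<union> {p :: real \<times> real. snd p < d})"
      by (intro open_Un open_Collect_less continuous_intros)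
    show "Gamma L1 L2 \<subseteq> {p. fst p < d} \<union> {p. snd p < d}"
      using d(1) by (auto simp: Gamma_def)
  qed (use smooth zero in auto)
  have X': "inX lam L1 L2 \<psi> (Top lam \<psi>)"
    using d(1) by (intro inX_smooth[OF assms(1,2) smooth] zero) (auto simp: Gamma_def)
  \<comment> \<open>The identity for T psi is available on Omega only, and the norm integrates over
    no more than that.\<close>
  have "(LINT p:Omega L1 L2|lborel. (g p - Top lam \<psi> p)\<^sup>2)
      = (LINT p:Omega L1 L2|lborel. (g p - convol G (kern2 d) p)\<^sup>2)"
    using Top_convol_kern2[OF assms(3) X d(1)]
    by (intro set_lebesgue_integral_cong) (auto simp: \<psi>_def F_def[abs_def] G_def[abs_def] Omega_sets)
  then have "(LINT p:Omega L1 L2|lborel. (\<theta> p - \<psi> p)\<^sup>2)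
      + (LINT p:Omega L1 L2|lborel. (g p - Top lam \<psi> p)\<^sup>2) \<le> \<epsilon>\<^sup>2 / 3 + \<epsilon>\<^sup>2 / 3"
    using d1(2)[OF d(1,2)] d2(2)[OF d(1,3)] by (simp add: \<psi>_def)
  also have "\<dots> < \<epsilon>\<^sup>2" using \<epsilon> by simp
  finally have "Xdist L1 L2 \<theta> g \<psi> (Top lam \<psi>) < \<epsilon>"
    unfolding Xdist_def using \<epsilon> by (intro real_less_lsqrt) auto
  with V X' show "\<exists>\<psi>. inV L1 L2 \<psi> \<and> inX lam L1 L2 \<psi> (Top lam \<psi>) \<and> Xdist L1 L2 \<theta> g \<psi> (Top lam \<psi>) < \<epsilon>"
    by blast
qed

end
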